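(* Let $n\ge1$ and let $g:[0,1)\to\mathbb{R}$ be continuous with $g(0)=0$. Suppose $\Omega$ is compactly contained in $\mathbb{B}^n$ and $f$ is nonnegative on $\Omega$ with $0<\int_\Omega f(y)(1-|y|^2)^{-n}\,dy<\infty$. If $\int_0^1 g(r)(1-r^2)^{-1}\,dr=\infty$, and a closed hyperbolic halfball $H=H(p,t)$ (with $p\in S^{n-1}$, $t\in(-1,1)$) and its fold map $F$ are given, then a point $x\in\mathbb{B}^n$ exists such that each component of the vector field $v\circ T_x\circ F$ is orthogonal to $f$, meaning $$\int_\Omega v\big(T_x(F(y))\big)\,f(y)\,(1-|y|^2)^{-n}\,dy=0.$$ If in addition $g$ is increasing with $g(r)>0$ whenever $0<r<1$, then the point $x=x(H)$ is unique and depends continuously on the parameters $(p,t)$ of $H$.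
   Context: $\mathbb{B}^n$ is the open unit ball centered at the origin in $\mathbb{R}^n$, $\overline{\mathbb{B}^n}$ its closure, $S^{n-1}$ the unit sphere, and $|\cdot|$ is the euclidean norm. For $x\in\mathbb{B}^n$ the M\"obius transformation $T_x:\overline{\mathbb{B}^n}\to\overline{\mathbb{B}^n}$ is $$T_x(y)=\frac{(1+2x\cdot y+|y|^2)x+(1-|x|^2)y}{1+2x\cdot y+|x|^2|y|^2},\qquad y\in\overline{\mathbb{B}^n},$$ with inverse $(T_x)^{-1}=T_{-x}$. The radial vector field $v:\mathbb{B}^n\to\mathbb{R}^n$ is $v(y)=g(|y|)\,y/|y|$ for $y\neq 0$ and $v(0)=0$. Halfballs and folds: for $p\in S^{n-1}$ let $H_p=\{y\in\mathbb{B}^n: y\cdot p\le0\}$, and for $t\in(-1,1)$ let $H=H(p,t)=T_{pt}(H_p)$, where $T_{pt}$ is the M\"obius transformation associated with the point $pt\in\mathbb{B}^n$. Let $R_p(y)=y-2(y\cdot p)p$ and let $R=R_{p,t}=T_{pt}\circ R_p\circ(T_{pt})^{-1}$ be the hyperbolic reflection across the boundary of $H(p,t)$ relative to $\mathbb{B}^n$. The fold map onto $H$ is given by $F(y)=y$ if $y\in H$ and $F(y)=R(y)$ if $y\in\mathbb{B}^n\setminus H$. The condition $\int_0^1 g(r)(1-r^2)^{-1}\,dr=\infty$ means $\int_0^\rho g(r)(1-r^2)^{-1}\,dr\to\infty$ as $\rho\to1^-$. "Increasing" means non-strictly increasing (nondecreasing). "Compactly contained" means the closure of $\Omega$ is a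 compact subset of $\mathbb{B}^n$. $dy$ is Lebesgue measure.
   Formalization: Uniqueness and continuous dependence of x(H) are stated for n≥2 with g increasing, and for n=1 only with g strictly increasing; for n=1 with g merely nondecreasing, uniqueness can fail (e.g. g(r)=min(100r,1), f=1 on two symmetric intervals). *)

theory Defs
  imports "HOL-Analysis.Analysis"
begin

text \<open>The weight \<open>(1 - |y|\<^sup>2)\<^sup>-\<^sup>n\<close> is written as division by \<open>(1 - |y|\<^sup>2)\<^sup>n\<close>, with \<open>n = CARD('n)\<close>.
  Maps of the unit ball are total functions; only their values on the (closed) ball matter.\<close>

definition mobius :: "real^'n \<Rightarrow> real^'n \<Rightarrow> real^'n" where
  "mobius x y =
     ((1 + 2 * (x \<bullet> y) + (norm y)\<^sup>2) *\<^sub>R x + (1 - (norm x)\<^sup>2) *\<^sub>R y)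
       /\<^sub>R (1 + 2 * (x \<bullet> y) + (norm x)\<^sup>2 * (norm y)\<^sup>2)"

definition radial_field :: "(real \<Rightarrow> real) \<Rightarrow> real^'n \<Rightarrow> real^'n" where
  "radial_field g y = (if y = 0 then 0 else g (norm y) *\<^sub>R (y /\<^sub>R norm y))"

definition halfball :: "real^'n \<Rightarrow> real \<Rightarrow> (real^'n) set" where
  "halfball p t = mobius (t *\<^sub>R p) ` {y \<in> ball 0 1. y \<bullet> p \<le> 0}"

definition reflect :: "real^'n \<Rightarrow> real^'n \<Rightarrow> real^'n" where
  "reflect p y = y - (2 * (y \<bullet> p)) *\<^sub>R p"

definition hyp_reflect :: "real^'n \<Rightarrow> real \<Rightarrow> real^'n \<Rightarrow> real^'n" where
  "hyp_reflect p t =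
     mobius (t *\<^sub>R p) \<circ> reflect p \<circ> inv_into (cball 0 1) (mobius (t *\<^sub>R p))"

definition fold_map :: "real^'n \<Rightarrow> real \<Rightarrow> real^'n \<Rightarrow> real^'n" where
  "fold_map p t y = (if y \<in> halfball p t then y else hyp_reflect p t y)"

definition compactly_contained :: "'a::topological_space set \<Rightarrow> 'a set \<Rightarrow> bool" where
  "compactly_contained A U \<longleftrightarrow> compact (closure A) \<and> closure A \<subseteq> U"

text \<open>Integrability is part of the next notion because the Bochner integral of a
  non-integrable function is \<open>0\<close> by convention.\<close>

definition orthogonal_on ::
    "(real^'n) set \<Rightarrow> (real^'n \<Rightarrow> real) \<Rightarrow> (real^'n \<Rightarrow> real^'n) \<Rightarrow> bool" where
  "orthogonal_on \<Omega> f w \<longleftrightarrow>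
     set_integrable lebesgue \<Omega> (\<lambda>y. (f y / (1 - (norm y)\<^sup>2) ^ CARD('n)) *\<^sub>R w y) \<and>
     (LINT y:\<Omega>|lebesgue. (f y / (1 - (norm y)\<^sup>2) ^ CARD('n)) *\<^sub>R w y) = 0"

end

(* Write |T_x y| for the norm of the Moebius image, M for the weighted measure, and
   Gamma(rho) for the integral of g(r) / (1 - r^2) over [0, rho].  The gradient of Gamma(|T_x y|)
   with respect to x is v(T_x y) / (1 - |x|^2), so the orthogonality condition says that x is a
   critical point of the energy E(x) = int Gamma(|T_x (F y)|) dM(y).  Divergence of Gamma makes E
   coercive, hence a minimizer exists.  If g is increasing and positive, Gamma(|T_x y|) is a convex
   increasing function of a hyperbolic distance, hence convex along geodesics, and strictly so
   if g is strictly increasing or the center of the distance is off the geodesic; in dimension at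
   least two the y violating the latter form a negligible set, also after the fold.  So every critical
   point is a strict global minimizer.  Continuity in (p, t) follows because E is jointly
   continuous and coercive locally uniformly in (p, t). *)
theory Submission imports Defs begin

subsection \<open>Moebius transformations of the ball\<close>

text \<open>\<open>norm (mobius x y)\<close> is tanh of half the hyperbolic distance from
  \<open>- x\<close> to \<open>y\<close>, so the energy adds up a function of the distances from one
  variable point to the folded mass. No geodesic is ever parametrized. Convexity enters as a
  first-order inequality at a critical point: each integrand lies above its tangent, all the
  tangents are taken along one common vector, and hence their linear parts integrate to the inner
  product of that vector with the moment, which is zero. No second derivative occurs, so continuity
  of \<open>g\<close> suffices. Of the fold only three properties matter: joint continuity in
  parameters and point, invariance of the ball, and null preimages of null sets. Null sets are
  harmless because the mass has a density with respect to Lebesgue measure.\<close>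

definition mobius_denom :: "real^'n \<Rightarrow> real^'n \<Rightarrow> real" where
  "mobius_denom x y = 1 + 2 * (x \<bullet> y) + (norm x)\<^sup>2 * (norm y)\<^sup>2"

text \<open>For nonzero x the denominator is |x|^2 |y + x/|x|^2|^2, a scaled squared distance from y
  to the pole. The bound makes it positive on the closed ball; for |y| at most b < 1 it stays above
  (1 - b)^2 even as |x| tends to 1, which coercivity requires.\<close>

lemma mobius_denom_ge: "(1 - norm x * norm y)\<^sup>2 \<le> mobius_denom x y"
  using Cauchy_Schwarz_ineq2[of x y]
  by (auto simp: mobius_denom_def power2_eq_square algebra_simps abs_le_iff)

lemma mobius_denom_pos:
  assumes "norm x < 1" "norm y \<le> 1"
  shows "0 < mobius_denom x y"
proof -
  have "norm x * norm y \<le> norm x * 1"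
    by (rule mult_left_mono) (use assms in auto)
  then have "0 < (1 - norm x * norm y)\<^sup>2" using assms by auto
  then show ?thesis using mobius_denom_ge[of x y] by linarith
qed

lemma mobius_eq:
  "mobius x y = ((1 + 2 * (x \<bullet> y) + (norm y)\<^sup>2) / mobius_denom x y) *\<^sub>R x
     + ((1 - (norm x)\<^sup>2) / mobius_denom x y) *\<^sub>R y"
  by (simp add: mobius_def mobius_denom_def scaleR_add_right divide_inverse_commute)

text \<open>The source of all metric facts below: invariance of the ball, the law of cosines and the
  gradient of the potential. Naming the three inner products reduces it to a polynomial
  identity.\<close>

lemma norm_mobius_sq:
  assumes "norm x < 1" "norm y \<le> 1"
  shows "(norm (mobius x y))\<^sup>2
    = 1 - (1 - (norm x)\<^sup>2) * (1 - (norm y)\<^sup>2) / mobius_denom x y"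
proof -
  define a b p where "a = x \<bullet> x" and "b = y \<bullet> y" and "p = x \<bullet> y"
  have D: "mobius_denom x y = 1 + 2 * p + a * b"
    by (simp add: mobius_denom_def a_def b_def p_def power2_norm_eq_inner)
  have D0: "1 + 2 * p + a * b \<noteq> 0"
    using mobius_denom_pos[OF assms] D by simp
  have "(norm (mobius x y))\<^sup>2 = (norm ((1 + 2 * p + b) *\<^sub>R x + (1 - a) *\<^sub>R y))\<^sup>2 / (1 + 2 * p + a * b)\<^sup>2"
    by (simp add: mobius_def power_mult_distrib divide_inverse power_inverse mult.commute
        a_def b_def p_def power2_norm_eq_inner[symmetric])
  also have "(norm ((1 + 2 * p + b) *\<^sub>R x + (1 - a) *\<^sub>R y))\<^sup>2
      = (1 + 2 * p + b)\<^sup>2 * a + 2 * (1 + 2 * p + b) * (1 - a) * p + (1 - a)\<^sup>2 * b"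
    unfolding power2_norm_eq_inner
    by (simp add: inner_add_left inner_add_right inner_commute[of y x] flip: a_def b_def p_def) algebra
  \<comment> \<open>The numerator is divisible by the denominator, so one factor of the square
    cancels.\<close>
  also have "\<dots> = (1 + 2 * p + a * b) * ((1 + 2 * p + a * b) - (1 - a) * (1 - b))"
    by algebra
  also have "\<dots> / (1 + 2 * p + a * b)\<^sup>2 = 1 - (1 - a) * (1 - b) / (1 + 2 * p + a * b)"
  proof -
    have "d * (d - u) / d\<^sup>2 = 1 - u / d" if "d \<noteq> 0" for d u :: real
      using that by (simp add: field_simps power2_eq_square)
    then show ?thesis using D0 by blast
  qed
  finally show ?thesis by (simp add: D a_def b_def power2_norm_eq_inner)
qed

lemma one_minus_norm_sq_pos: "norm x < 1 \<Longrightarrow> 0 < 1 - (norm x)\<^sup>2"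
  by (simp add: abs_square_less_1)

lemma norm_mobius_lt:
  assumes "norm x < 1" "norm y < 1"
  shows "norm (mobius x y) < 1"
proof -
  have "0 < 1 - (norm x)\<^sup>2" "0 < 1 - (norm y)\<^sup>2"
    using assms by (auto simp: abs_square_less_1)
  then have "(norm (mobius x y))\<^sup>2 < 1"
    using norm_mobius_sq[of x y] mobius_denom_pos[of x y] assms by simp
  then show ?thesis by (simp add: abs_square_less_1)
qed

lemma mobius_0_left [simp]: "mobius 0 y = y"
  by (simp add: mobius_def)

lemma mobius_0_right [simp]: "mobius x 0 = x"
  by (simp add: mobius_def)

text \<open>With \<open>z = mobius x y\<close>, both the numerator and the denominator for
  \<open>- x\<close> at \<open>z\<close> are explicit in \<open>a\<close>, \<open>b\<close>,
  \<open>p\<close>; the two multiples of \<open>x\<close> cancel and the coefficient of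
  \<open>y\<close> becomes 1.\<close>

lemma mobius_inverse:
  assumes x: "norm x < 1" and y: "norm y \<le> 1"
  shows "mobius (- x) (mobius x y) = y"
proof -
  define a b p where "a = x \<bullet> x" and "b = y \<bullet> y" and "p = x \<bullet> y"
  define D where "D = 1 + 2 * p + a * b"
  have D: "mobius_denom x y = D"
    by (simp add: mobius_denom_def a_def b_def p_def D_def power2_norm_eq_inner)
  have D0: "D \<noteq> 0"
    using mobius_denom_pos[OF assms] D by simp
  have a1: "1 - a \<noteq> 0"
    using x unfolding a_def power2_norm_eq_inner[symmetric]
    by (metis abs_norm_cancel abs_square_less_1 diff_gt_0_iff_gt less_irrefl)
  define z where "z = mobius x y"
  have z: "z = ((1 + 2 * p + b) / D) *\<^sub>R x + ((1 - a) / D) *\<^sub>R y"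
    by (simp add: z_def mobius_eq D a_def b_def p_def power2_norm_eq_inner)
  have xz: "x \<bullet> z = ((1 + 2 * p + b) * a + (1 - a) * p) / D"
    unfolding z inner_add_right inner_scaleR_right a_def[symmetric] p_def[symmetric]
    by (metis add_divide_distrib times_divide_eq_left)
  have zz: "(norm z)\<^sup>2 = 1 - (1 - a) * (1 - b) / D"
    using norm_mobius_sq[OF assms] by (simp add: z_def D a_def b_def power2_norm_eq_inner)
  have den: "mobius_denom (-x) z = (1 - a)\<^sup>2 / D"
    unfolding mobius_denom_def norm_minus_cancel zz
    using D0 by (simp add: xz power2_norm_eq_inner flip: a_def)
      (simp add: field_simps power2_eq_square, simp add: D_def algebra_simps)
  have num: "1 + 2 * ((- x) \<bullet> z) + (norm z)\<^sup>2 = (1 - a) * (1 + 2 * p + b) / D"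
    unfolding zz using D0 by (simp add: xz) (simp add: field_simps, simp add: D_def algebra_simps)
  have "mobius (- x) z = (((1 - a) * (1 + 2 * p + b) / D) / ((1 - a)\<^sup>2 / D)) *\<^sub>R (- x)
      + ((1 - a) / ((1 - a)\<^sup>2 / D)) *\<^sub>R z"
    unfolding mobius_eq[of "-x"] num den norm_minus_cancel by (simp add: a_def power2_norm_eq_inner)
  also have "\<dots> = y"
    unfolding z using D0 a1 by (simp add: scaleR_add_right power2_eq_square)
  finally show ?thesis by (simp add: z_def)
qed

lemma mobius_inverse':
  assumes x: "norm x < 1" and y: "norm y \<le> 1"
  shows "mobius x (mobius (- x) y) = y"
  using mobius_inverse[of "-x" y] assms by simp

text \<open>\<open>mobius x\<close> is a hyperbolic isometry and sends \<open>- x'\<close> to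
  \<open>- mobius (- x) x'\<close>, so both sides measure the same distance. The maps themselves
  agree only up to an orthogonal transformation, hence the restriction to norms.\<close>

lemma norm_mobius_cocycle:
  assumes x: "norm x < 1" and x': "norm x' < 1" and y: "norm y < 1"
  shows "norm (mobius (mobius (- x) x') (mobius x y)) = norm (mobius x' y)"
proof -
  define a b c p q r where "a = x \<bullet> x" and "b = x' \<bullet> x'" and "c = y \<bullet> y"
    and "p = x \<bullet> x'" and "q = x \<bullet> y" and "r = x' \<bullet> y"
  note defs = a_def b_def c_def p_def q_def r_def
  define D1 D2 where "D1 = 1 - 2 * p + a * b" and "D2 = 1 + 2 * q + a * c"
  have D1: "mobius_denom (-x) x' = D1" and D2: "mobius_denom x y = D2"
    and D3: "mobius_denom x' y = 1 + 2 * r + b * c"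
    by (simp_all add: mobius_denom_def D1_def D2_def defs power2_norm_eq_inner)
  have D0: "D1 \<noteq> 0" "D2 \<noteq> 0" "1 + 2 * r + b * c \<noteq> 0"
    using mobius_denom_pos[of "-x" x'] mobius_denom_pos[of x y] mobius_denom_pos[of x' y] assms D1 D2 D3 by simp_all
  have a1: "1 - a \<noteq> 0"
    using x unfolding a_def power2_norm_eq_inner[symmetric]
    by (metis abs_norm_cancel abs_square_less_1 diff_gt_0_iff_gt less_irrefl)
  define w z where "w = mobius (-x) x'" and "z = mobius x y"
  have w: "w = ((1 - 2 * p + b) / D1) *\<^sub>R (- x) + ((1 - a) / D1) *\<^sub>R x'"
    by (simp add: w_def mobius_eq D1 defs power2_norm_eq_inner)
  have z: "z = ((1 + 2 * q + c) / D2) *\<^sub>R x + ((1 - a) / D2) *\<^sub>R y"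
    by (simp add: z_def mobius_eq D2 defs power2_norm_eq_inner)
  have wz: "w \<bullet> z = (- (1 - 2*p + b) * (1 + 2*q + c) * a - (1 - 2*p + b) * (1 - a) * q
       + (1 - a) * (1 + 2*q + c) * p + (1 - a)\<^sup>2 * r) / (D1 * D2)"
  proof -
    have "((k / D1) *\<^sub>R (- x) + (l / D1) *\<^sub>R x') \<bullet> ((m / D2) *\<^sub>R x + (n / D2) *\<^sub>R y)
        = (- k * m * a - k * n * q + l * m * p + l * n * r) / (D1 * D2)" for k l m n :: real
      using D0 by (simp add: inner_diff_left inner_add_right inner_commute[of x' x] flip: defs)
        (simp add: field_simps)
    then show ?thesis
      unfolding w z power2_eq_square .
  qed
  have ww: "(norm w)\<^sup>2 = 1 - (1 - a) * (1 - b) / D1"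
    using norm_mobius_sq[of "-x" x'] assms by (simp add: w_def D1 defs power2_norm_eq_inner)
  have zz: "(norm z)\<^sup>2 = 1 - (1 - a) * (1 - c) / D2"
    using norm_mobius_sq[of x y] assms by (simp add: z_def D2 defs power2_norm_eq_inner)
  \<comment> \<open>The denominators satisfy a multiplicative cocycle identity;
    \<open>norm_mobius_sq\<close> then carries it over to the norms.\<close>
  have wz': "mobius_denom w z = (1 - a)\<^sup>2 * (1 + 2 * r + b * c) / (D1 * D2)"
  proof -
    have "D1 * D2 + 2 * (- (1 - 2*p + b) * (1 + 2*q + c) * a - (1 - 2*p + b) * (1 - a) * q
       + (1 - a) * (1 + 2*q + c) * p + (1 - a)\<^sup>2 * r) + (D1 - (1 - a) * (1 - b)) * (D2 - (1 - a) * (1 - c))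
      = (1 - a)\<^sup>2 * (1 + 2 * r + b * c)"
      unfolding D1_def D2_def by algebra
    moreover have "(norm w)\<^sup>2 * (norm z)\<^sup>2 = (D1 - (1 - a) * (1 - b)) * (D2 - (1 - a) * (1 - c)) / (D1 * D2)"
      unfolding ww zz using D0 by (simp add: field_simps)
    moreover have "1 = D1 * D2 / (D1 * D2)" using D0 by simp
    ultimately show ?thesis
      unfolding mobius_denom_def wz times_divide_eq_right
      by (metis add_divide_distrib)
  qed
  have lt: "norm w < 1" "norm z < 1"
    using norm_mobius_lt[of "-x" x'] norm_mobius_lt[of x y] assms by (auto simp: w_def z_def)
  have n: "(norm x')\<^sup>2 = b" "(norm y)\<^sup>2 = c"
    by (simp_all add: defs power2_norm_eq_inner)
  have "(norm (mobius w z))\<^sup>2 = (norm (mobius x' y))\<^sup>2"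
    unfolding norm_mobius_sq[OF lt(1) less_imp_le[OF lt(2)]] norm_mobius_sq[OF x' less_imp_le[OF y]] wz' D3 ww zz n
    using D0 a1 by (simp add: divide_simps power2_eq_square)
  then show ?thesis by (simp add: w_def z_def)
qed

lemma continuous_on_mobius [continuous_intros]:
  assumes "continuous_on S f" "continuous_on S h"
    and "\<And>s. s \<in> S \<Longrightarrow> norm (f s) < 1" "\<And>s. s \<in> S \<Longrightarrow> norm (h s) \<le> 1"
  shows "continuous_on S (\<lambda>s. mobius (f s) (h s))"
  unfolding mobius_eq mobius_denom_def
  by (intro continuous_intros assms)
     (metis assms(3,4) mobius_denom_def mobius_denom_pos less_irrefl)+

lemma differentiable_mobius_right:
  assumes "norm x < 1" "norm y \<le> 1"
  shows "mobius x differentiable (at y)"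
  unfolding mobius_eq mobius_denom_def power2_norm_eq_inner
  using mobius_denom_pos[OF assms]
  by (intro derivative_intros) (auto simp: mobius_denom_def power2_norm_eq_inner)

lemma differentiable_mobius_left:
  assumes "norm x < 1" "norm y \<le> 1"
  shows "(\<lambda>x. mobius x y) differentiable (at x)"
  unfolding mobius_eq mobius_denom_def power2_norm_eq_inner
  using mobius_denom_pos[OF assms]
  by (intro derivative_intros) (auto simp: mobius_denom_def power2_norm_eq_inner)

subsection \<open>Hyperbolic law of cosines\<close>

text \<open>In the metric of curvature -1 a point of norm r has distance \<open>2 * artanh r\<close>
  from the origin; these are the half-argument formulas for r = tanh of half that distance.\<close>

lemma cosh_artanh_double:
  fixes r :: real
  assumes "\<bar>r\<bar> < 1"
  shows "cosh (2 * artanh r) = (1 + r\<^sup>2) / (1 - r\<^sup>2)"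
    and "sinh (2 * artanh r) = 2 * r / (1 - r\<^sup>2)"
proof -
  have r: "0 < 1 + r" "0 < 1 - r" using assms by auto
  have e: "exp (2 * artanh r) = (1 + r) / (1 - r)"
    using r by (simp add: artanh_def)
  have d: "1 - r\<^sup>2 = (1 + r) * (1 - r)" by algebra
  show "cosh (2 * artanh r) = (1 + r\<^sup>2) / (1 - r\<^sup>2)"
    using r unfolding cosh_def exp_minus e d
    by (simp add: divide_simps power2_eq_square) (simp add: algebra_simps)
  show "sinh (2 * artanh r) = 2 * r / (1 - r\<^sup>2)"
    using r unfolding sinh_def exp_minus e d
    by (simp add: divide_simps power2_eq_square) (simp add: algebra_simps)
qed

lemma artanh_pos:
  fixes r :: real
  assumes "0 < r" "r < 1"
  shows "0 < artanh r"
  using assms by (simp add: artanh_def)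

lemma artanh_nonneg:
  fixes r :: real
  assumes "0 \<le> r" "r < 1"
  shows "0 \<le> artanh r"
  using assms artanh_pos[of r] by (cases "r = 0") auto

text \<open>\<open>a + b * c\<close> is the mean of \<open>a + b\<close> and \<open>a - b\<close>
  with weights (1 + c)/2 and (1 - c)/2. The tangent to exp at this mean lies strictly below exp at
  both ends, and the weighted linear terms cancel.\<close>

lemma exp_strict_convex:
  fixes a b c :: real
  assumes "b \<noteq> 0" "\<bar>c\<bar> < 1"
  shows "exp (a + b * c) < (1 + c) / 2 * exp (a + b) + (1 - c) / 2 * exp (a - b)"
proof -
  have gt: "1 + u < exp u" if "u \<noteq> 0" for u :: real
    using that exp_ge_add_one_self[of u] exp_minus_greater[of "-u"] by (simp add: less_le)
  define u where "u = a + b * c"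
  have "exp u = exp u * ((1 + c) / 2 * (1 + b * (1 - c)) + (1 - c) / 2 * (1 + (- b * (1 + c))))"
    by (simp add: field_simps)
  also have "\<dots> < exp u * ((1 + c) / 2 * exp (b * (1 - c)) + (1 - c) / 2 * exp (- b * (1 + c)))"
    using assms by (intro mult_strict_left_mono add_strict_mono gt) auto
  also have "\<dots> = (1 + c) / 2 * exp (a + b) + (1 - c) / 2 * exp (a - b)"
    by (simp add: u_def algebra_simps flip: exp_add)
  finally show ?thesis by (simp add: u_def)
qed

text \<open>As a function of \<open>c\<close> the right-hand side is the chord of the left-hand side over
  \<open>[-1, 1]\<close>, and the left-hand side is strictly convex.\<close>

lemma cosh_chord:
  fixes a b c :: real
  assumes "\<bar>c\<bar> \<le> 1"
  shows "cosh (a + b * c) \<le> cosh a * cosh b + c * sinh a * sinh b" (is "?l \<le> ?r")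
    and "b \<noteq> 0 \<Longrightarrow> \<bar>c\<bar> < 1 \<Longrightarrow> cosh (a + b * c) < cosh a * cosh b + c * sinh a * sinh b"
proof -
  have r: "?r = (1 + c) / 2 * cosh (a + b) + (1 - c) / 2 * cosh (a - b)"
    by (simp add: cosh_add cosh_diff field_simps)
  show strict: "?l < ?r" if "b \<noteq> 0" "\<bar>c\<bar> < 1"
    using exp_strict_convex[of b c a] exp_strict_convex[of "-b" c "-a"] that
    unfolding r unfolding cosh_def by (simp add: algebra_simps)
  consider "b = 0" | "c = 1" | "c = -1" | "b \<noteq> 0" "\<bar>c\<bar> < 1"
    using assms by fastforce
  then show "?l \<le> ?r"
    by cases (use strict in \<open>auto simp: cosh_add cosh_diff\<close>)
qed

text \<open>This is the convexity of the hyperbolic distance to a point along a geodesic through the origin.\<close>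

lemma artanh_norm_mobius_ge:
  fixes w z :: "real^'n"
  assumes w: "norm w < 1" "w \<noteq> 0" and z: "norm z < 1" "z \<noteq> 0"
  defines "c \<equiv> w \<bullet> z / (norm w * norm z)"
  shows "artanh (norm z) + c * artanh (norm w) \<le> artanh (norm (mobius w z))"
    and "\<bar>c\<bar> < 1 \<Longrightarrow> artanh (norm z) + c * artanh (norm w) < artanh (norm (mobius w z))"
proof -
  define m where "m = norm (mobius w z)"
  have m1: "m < 1" "0 \<le> m" using norm_mobius_lt w z by (auto simp: m_def)
  have w1: "1 - (norm w)\<^sup>2 \<noteq> 0" and z1: "1 - (norm z)\<^sup>2 \<noteq> 0" and m0: "1 - m\<^sup>2 \<noteq> 0"
    using w z m1 abs_square_less_1[of "norm w"] abs_square_less_1[of "norm z"] abs_square_less_1[of m] by auto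
  have c1: "\<bar>c\<bar> \<le> 1"
    using Cauchy_Schwarz_ineq2[of w z] w z by (simp add: c_def abs_mult)
  have m2: "1 - m\<^sup>2 = (1 - (norm w)\<^sup>2) * (1 - (norm z)\<^sup>2) / mobius_denom w z"
    using norm_mobius_sq[of w z] w z by (simp add: m_def)
  have D0: "mobius_denom w z \<noteq> 0" using mobius_denom_pos[of w z] w z by simp
  \<comment> \<open>Law of cosines: written this way, \<open>m\<close> enters only through 1 - m^2.
    The distance runs from \<open>- w\<close> to \<open>z\<close>, so the cosine of the enclosed
    angle is \<open>- c\<close> and the product term has a plus sign.\<close>
  have "cosh (2 * artanh m) = 2 / (1 - m\<^sup>2) - 1"
    using m1 m0 by (subst cosh_artanh_double) (auto simp: field_simps)
  also have "\<dots> = (2 * mobius_denom w z - (1 - (norm w)\<^sup>2) * (1 - (norm z)\<^sup>2)) / ((1 - (norm w)\<^sup>2) * (1 - (norm z)\<^sup>2))"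
    using w1 z1 D0 unfolding m2 by (simp add: diff_divide_distrib)
  also have "2 * mobius_denom w z - (1 - (norm w)\<^sup>2) * (1 - (norm z)\<^sup>2)
     = (1 + (norm z)\<^sup>2) * (1 + (norm w)\<^sup>2) + c * (2 * norm z) * (2 * norm w)"
    using w z by (simp add: mobius_denom_def c_def algebra_simps)
  also have "\<dots> / ((1 - (norm w)\<^sup>2) * (1 - (norm z)\<^sup>2)) =
     cosh (2 * artanh (norm z)) * cosh (2 * artanh (norm w)) +
      c * sinh (2 * artanh (norm z)) * sinh (2 * artanh (norm w))"
  proof -
    have "(p * q + k * u * v) / (s * t) = p / t * (q / s) + k * (u / t) * (v / s)" for k p q s t u v :: real
      by (simp add: add_divide_distrib mult.commute)
    then show ?thesis using w z by (simp only: cosh_artanh_double abs_norm_cancel)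
  qed
  finally have cosines: "cosh (2 * artanh m) = \<dots>" .
  have a0: "0 \<le> artanh m" "artanh (norm w) \<noteq> 0"
    using artanh_nonneg m1 artanh_pos[of "norm w"] w by auto
  \<comment> \<open>cosh can be inverted only on nonnegative arguments and \<open>?s\<close> may be
    negative, hence the absolute values.\<close>
  let ?s = "2 * artanh (norm z) + 2 * artanh (norm w) * c"
  have "cosh \<bar>?s\<bar> \<le> cosh (2 * artanh m)"
    unfolding cosines cosh_real_abs by (rule cosh_chord) (rule c1)
  then have "\<bar>?s\<bar> \<le> 2 * artanh m" using a0 by (subst (asm) cosh_real_nonneg_le_iff) auto
  then show "artanh (norm z) + c * artanh (norm w) \<le> artanh (norm (mobius w z))"
    by (simp add: m_def mult.commute)
  assume "\<bar>c\<bar> < 1"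
  then have "cosh \<bar>?s\<bar> < cosh (2 * artanh m)"
    unfolding cosines cosh_real_abs by (intro cosh_chord) (use a0 in auto)
  then have "\<bar>?s\<bar> < 2 * artanh m" using a0 by (subst (asm) cosh_real_nonneg_less_iff) auto
  then show "artanh (norm z) + c * artanh (norm w) < artanh (norm (mobius w z))"
    by (simp add: m_def mult.commute)
qed

subsection \<open>The radial potential\<close>

definition potential :: "(real \<Rightarrow> real) \<Rightarrow> real \<Rightarrow> real" where
  "potential g \<rho> = integral {0..\<rho>} (\<lambda>r. g r / (1 - r\<^sup>2))"

locale radial_profile =
  fixes g :: "real \<Rightarrow> real"
  assumes g_cont: "continuous_on {0..<1} g" and g0: "g 0 = 0"
begin

lemma continuous_on_density: "b < 1 \<Longrightarrow> continuous_on {0..b} (\<lambda>r. g r / (1 - r\<^sup>2))"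
  by (intro continuous_intros continuous_on_subset[OF g_cont])
     (auto simp: power2_eq_1_iff)

lemma potential_0 [simp]: "potential g 0 = 0"
  by (simp add: potential_def)

lemma potential_has_derivative_within:
  assumes "0 \<le> r" "r \<le> b" "b < 1"
  shows "(potential g has_real_derivative g r / (1 - r\<^sup>2)) (at r within {0..b})"
  unfolding potential_def[abs_def]
  by (rule integral_has_real_derivative[OF continuous_on_density]) (use assms in auto)

lemma potential_has_derivative:
  assumes "0 < r" "r < 1"
  shows "(potential g has_real_derivative g r / (1 - r\<^sup>2)) (at r)"
proof -
  have "at r within {0..(r + 1) / 2} = at r"
    by (rule at_within_interior) (use assms in auto)
  then show ?thesis
    using potential_has_derivative_within[of r "(r + 1) / 2"] assms by simp
qed

lemma continuous_on_potential: "continuous_on {0..<1} (potential g)"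
proof (clarsimp simp: continuous_on_eq_continuous_within)
  fix r :: real assume r: "0 \<le> r" "r < 1"
  define b where "b = (r + 1) / 2"
  have b: "r < b" "b < 1" using r by (auto simp: b_def)
  have "at r within {0..<1} = at r within {0..b}"
  proof (rule at_within_nhd)
    show "{0..<1} \<inter> {..<b} - {r} = {0..b} \<inter> {..<b} - {r}" using b by auto
  qed (use b in auto)
  moreover have "continuous (at r within {0..b}) (potential g)"
    using potential_has_derivative_within[of r b] r b by (intro DERIV_continuous) auto
  ultimately show "continuous (at r within {0..<1}) (potential g)" by simp
qed

lemma norm_radial_field: "norm (radial_field g y) = \<bar>g (norm y)\<bar>"
  by (simp add: radial_field_def g0 abs_mult)

lemma continuous_on_radial_field: "continuous_on (ball 0 1) (radial_field g :: real^'n \<Rightarrow> real^'n)"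
proof -
  have gn: "continuous_on (ball 0 1) (\<lambda>y :: real^'n. g (norm y))"
    by (rule continuous_on_compose2[OF g_cont]) (auto intro!: continuous_intros)
  have "continuous (at z) (radial_field g)" if z: "norm z < 1" for z :: "real^'n"
  proof (cases "z = 0")
    case True
    have "((\<lambda>y :: real^'n. g (norm y)) \<longlongrightarrow> 0) (at 0)"
    proof -
      have "continuous (at 0) (\<lambda>y :: real^'n. g (norm y))"
        using gn by (subst (asm) continuous_on_eq_continuous_at) auto
      then show ?thesis by (simp add: continuous_at g0)
    qed
    then have "(radial_field g \<longlongrightarrow> (0 :: real^'n)) (at 0)"
      by (subst tendsto_norm_zero_iff[symmetric]) (simp add: norm_radial_field tendsto_rabs_zero)
    then show ?thesis
      using True by (simp add: continuous_at radial_field_def)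
  next
    case False
    have "continuous_on (ball 0 1 - {0}) (\<lambda>y :: real^'n. g (norm y) *\<^sub>R (y /\<^sub>R norm y))"
      by (intro continuous_intros continuous_on_subset[OF gn]) auto
    then have "continuous_on (ball 0 1 - {0}) (radial_field g :: real^'n \<Rightarrow> real^'n)"
      by (rule continuous_on_cong[THEN iffD1, rotated -1]) (auto simp: radial_field_def)
    then show ?thesis
      using False z by (subst (asm) continuous_on_eq_continuous_at) (auto simp: open_Diff)
  qed
  then show ?thesis by (auto simp: continuous_on_eq_continuous_at)
qed

text \<open>At the origin the norm is not differentiable, but the potential is \<open>o(\<rho>)\<close> because \<open>g 0 = 0\<close>.\<close>

lemma potential_norm_has_derivative_0:
  "((\<lambda>y :: real^'n. potential g (norm y)) has_derivative (\<lambda>h. 0)) (at 0)"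
proof -
  have "(potential g has_real_derivative 0) (at 0 within {0..1/2})"
    using potential_has_derivative_within[of 0 "1/2"] by (simp add: g0)
  then have "((\<lambda>\<rho>. potential g \<rho> / \<rho>) \<longlongrightarrow> 0) (at 0 within {0..1/2})"
    by (simp add: has_field_derivative_iff)
  moreover have "filterlim (norm :: real^'n \<Rightarrow> real) (at 0 within {0..1/2}) (at 0)"
    unfolding filterlim_at
  proof
    show "\<forall>\<^sub>F x :: real^'n in at 0. norm x \<in> {0..1/2} \<and> norm x \<noteq> 0"
      unfolding eventually_at by (rule exI[of _ "1/2"]) (auto simp: dist_norm)
    show "((norm :: real^'n \<Rightarrow> real) \<longlongrightarrow> 0) (at 0)"
      by (rule tendsto_norm_zero) (rule tendsto_ident_at)
  qed
  ultimately have "((\<lambda>y :: real^'n. potential g (norm y) / norm y) \<longlongrightarrow> 0) (at 0)"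
    by (rule filterlim_compose)
  then have "((\<lambda>y :: real^'n. norm (potential g (norm y) / norm y)) \<longlongrightarrow> 0) (at 0)"
    by (rule tendsto_norm_zero)
  then show ?thesis
    by (simp add: has_derivative_at)
qed

text \<open>By \<open>norm_mobius_sq\<close> the squared norm is a rational function
  \<open>q\<close> of \<open>x\<close>, so the map is the potential of sqrt (q x). The square root
  is singular where \<open>mobius x y\<close> is zero; there the vanishing derivative of the
  potential at the origin takes over.\<close>

lemma potential_mobius_has_derivative:
  fixes x y :: "real^'n"
  assumes x: "norm x < 1" and y: "norm y < 1"
  shows "((\<lambda>x. potential g (norm (mobius x y))) has_derivative
     (\<lambda>h. radial_field g (mobius x y) \<bullet> h / (1 - (norm x)\<^sup>2))) (at x)"
proof (cases "mobius x y = 0")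
  case True
  obtain T' where "((\<lambda>x. mobius x y) has_derivative T') (at x)"
    using differentiable_mobius_left[of x y] assms by (auto simp: differentiable_def)
  from diff_chain_at[OF this, of "\<lambda>y. potential g (norm y)" "\<lambda>h. 0"]
  show ?thesis
    using True potential_norm_has_derivative_0 by (simp add: o_def radial_field_def)
next
  case False
  define \<rho> where "\<rho> = norm (mobius x y)"
  have \<rho>: "0 < \<rho>" "\<rho> < 1" using False norm_mobius_lt[OF x y] by (auto simp: \<rho>_def)
  define D where "D = mobius_denom x y"
  define q where "q = (\<lambda>x. 1 - (1 - x \<bullet> x) * (1 - y \<bullet> y) / (1 + 2 * (x \<bullet> y) + (x \<bullet> x) * (y \<bullet> y)))"
  have D: "D = 1 + 2 * (x \<bullet> y) + (x \<bullet> x) * (y \<bullet> y)"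
    by (simp add: D_def mobius_denom_def power2_norm_eq_inner)
  have D0: "D > 0"
    using mobius_denom_pos[of x y] assms by (simp add: D_def)
  have x1: "x \<bullet> x \<noteq> 1"
    using one_minus_norm_sq_pos[OF x] by (simp add: power2_norm_eq_inner)
  have q: "norm (mobius z y) = sqrt (q z)" if "norm z < 1" for z
    using norm_mobius_sq[of z y] that y
    by (simp add: q_def mobius_denom_def power2_norm_eq_inner real_sqrt_unique flip: power2_norm_eq_inner)
  have qx: "q x = \<rho>\<^sup>2" using q[OF x] \<rho> by (simp add: \<rho>_def)
  have \<rho>2: "1 - \<rho>\<^sup>2 = (1 - x \<bullet> x) * (1 - y \<bullet> y) / D"
    by (simp add: qx[symmetric] q_def D)
  define q' where "q' = (\<lambda>h. (2 * (x \<bullet> h) * (1 - y \<bullet> y) * D + (1 - x \<bullet> x) * (1 - y \<bullet> y) * (2 * (h \<bullet> y) + 2 * (x \<bullet> h) * (y \<bullet> y))) / D\<^sup>2)"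
  have "(q has_derivative q') (at x)"
    unfolding q_def q'_def using D0 unfolding D
    by (auto intro!: derivative_eq_intros simp: fun_eq_iff inner_commute field_simps power2_eq_square)
      (simp add: minus_divide_left del: divide_minus_left)
  moreover have "((\<lambda>s. potential g (sqrt s)) has_real_derivative g \<rho> / (1 - \<rho>\<^sup>2) / (2 * \<rho>)) (at (q x))"
  proof -
    have "(potential g has_real_derivative g \<rho> / (1 - \<rho>\<^sup>2)) (at (sqrt (q x)))"
      using potential_has_derivative[OF \<rho>] \<rho> by (simp add: qx)
    moreover have "(sqrt has_real_derivative inverse (sqrt (q x)) / 2) (at (q x))"
      using DERIV_real_sqrt[of "q x"] \<rho> by (simp add: qx)
    ultimately show ?thesis
      using DERIV_chain2[of "potential g"] \<rho> by (fastforce simp: qx field_simps)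
  qed
  ultimately have "((\<lambda>x. potential g (sqrt (q x))) has_derivative (\<lambda>h. g \<rho> / (1 - \<rho>\<^sup>2) / (2 * \<rho>) * q' h)) (at x)"
    using DERIV_compose_FDERIV[where f = "\<lambda>s. potential g (sqrt s)"] by (fastforce simp: mult.commute)
  also have "(\<lambda>h. g \<rho> / (1 - \<rho>\<^sup>2) / (2 * \<rho>) * q' h) = (\<lambda>h. radial_field g (mobius x y) \<bullet> h / (1 - (norm x)\<^sup>2))"
  proof
    fix h
    have c1: "1 - y \<bullet> y \<noteq> 0"
      using one_minus_norm_sq_pos[OF y] by (simp add: power2_norm_eq_inner)
    \<comment> \<open>\<open>k / D\<close> is the inner product of \<open>mobius x y\<close> with
      \<open>h\<close>. Dividing \<open>q' h\<close> by 1 - \<rho>^2 cancels the factor 1 - |y|^2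
      and one power of \<open>D\<close>.\<close>
    define k where "k = (x \<bullet> h) * (1 + 2 * (x \<bullet> y) + y \<bullet> y) + (1 - x \<bullet> x) * (y \<bullet> h)"
    have k: "(x \<bullet> h) * D + (1 - x \<bullet> x) * (y \<bullet> h + (x \<bullet> h) * (y \<bullet> y)) = k"
      unfolding D k_def by algebra
    have "q' h = 2 * (1 - y \<bullet> y) * ((x \<bullet> h) * D + (1 - x \<bullet> x) * (y \<bullet> h + (x \<bullet> h) * (y \<bullet> y))) / D\<^sup>2"
      unfolding q'_def by (simp add: inner_commute[of h y] algebra_simps)
    then have "q' h / (1 - \<rho>\<^sup>2) = 2 * (k / D / (1 - x \<bullet> x))"
      unfolding k \<rho>2 using D0 x1 c1 by (simp add: divide_simps power2_eq_square)
    moreover have "mobius x y \<bullet> h = k / D"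
      by (simp add: mobius_def k_def D inner_add_left inner_add_right power2_norm_eq_inner divide_inverse mult.commute)
    ultimately have "q' h / (1 - \<rho>\<^sup>2) = 2 * (mobius x y \<bullet> h / (1 - x \<bullet> x))" by simp
    then have *: "g \<rho> / (2 * \<rho>) * (q' h / (1 - \<rho>\<^sup>2)) = g \<rho> / \<rho> * (mobius x y \<bullet> h / (1 - x \<bullet> x))"
      by simp
    have "g \<rho> / (1 - \<rho>\<^sup>2) / (2 * \<rho>) * q' h = g \<rho> / (2 * \<rho>) * (q' h / (1 - \<rho>\<^sup>2))"
      by simp
    also note *
    also have "g \<rho> / \<rho> * (mobius x y \<bullet> h / (1 - x \<bullet> x)) = radial_field g (mobius x y) \<bullet> h / (1 - (norm x)\<^sup>2)"
      using False by (simp add: radial_field_def \<rho>_def power2_norm_eq_inner[of x] divide_inverse)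
    finally show "g \<rho> / (1 - \<rho>\<^sup>2) / (2 * \<rho>) * q' h = radial_field g (mobius x y) \<bullet> h / (1 - (norm x)\<^sup>2)" .
  qed
  finally have "((\<lambda>x. potential g (sqrt (q x))) has_derivative (\<lambda>h. radial_field g (mobius x y) \<bullet> h / (1 - (norm x)\<^sup>2))) (at x)" .
  then show ?thesis
    by (rule has_derivative_transform_within_open[OF _ open_ball[of 0 1]]) (use x in \<open>auto simp: q\<close>)
qed

text \<open>Since artanh has derivative 1/(1 - r^2), the potential has slope \<open>g\<close> as a
  function of artanh r. An increasing \<open>g\<close> makes it convex in that variable, so it lies
  above its tangents.\<close>

lemma potential_tangent:
  assumes mono: "mono_on {0..<1} g" and r: "r \<in> {0..<1}" "s \<in> {0..<1}"
  shows "potential g r + g r * (artanh s - artanh r) \<le> potential g s"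
    and "strict_mono_on {0..<1} g \<Longrightarrow> r \<noteq> s \<Longrightarrow>
      potential g r + g r * (artanh s - artanh r) < potential g s"
proof -
  \<comment> \<open>The derivative of \<open>k\<close> has the sign of \<open>g u - g r\<close>, so
    \<open>k\<close> is smallest at \<open>r\<close>. The mean value point lies strictly inside the
    interval, which avoids a two-sided derivative at 0.\<close>
  define k where "k = (\<lambda>u. potential g u - g r * artanh u)"
  have k_cont: "continuous_on {0..<1} k"
    unfolding k_def by (intro continuous_intros continuous_on_potential) auto
  have k': "(k has_real_derivative (g u - g r) / (1 - u\<^sup>2)) (at u)" if "0 < u" "u < 1" for u
    unfolding k_def using that
    by (auto intro!: derivative_eq_intros potential_has_derivative simp: diff_divide_distrib)
  have mvt: "\<exists>u. a < u \<and> u < b \<and> k b - k a = (b - a) * ((g u - g r) / (1 - u\<^sup>2))"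
    if ab: "0 \<le> a" "a < b" "b < 1" for a b
  proof -
    have "continuous_on {a..b} k"
      by (rule continuous_on_subset[OF k_cont]) (use ab in auto)
    moreover have "k differentiable (at u)" if "a < u" "u < b" for u
      using k'[of u] ab that real_differentiable_def by fastforce
    ultimately obtain l u where u: "a < u" "u < b" "DERIV k u :> l" "k b - k a = (b - a) * l"
      using MVT[OF ab(2)] by blast
    then have "l = (g u - g r) / (1 - u\<^sup>2)"
      using DERIV_unique[OF u(3) k'[of u]] ab by simp
    then show ?thesis using u by blast
  qed
  have u2: "0 < 1 - u\<^sup>2" if "0 < u" "u < 1" for u :: real
    using that by (simp add: abs_square_less_1)
  consider "r = s" | "r < s" | "s < r" by linarith
  then have "k r \<le> k s \<and> (strict_mono_on {0..<1} g \<longrightarrow> r \<noteq> s \<longrightarrow> k r < k s)"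
  proof cases
    case 2
    then obtain u where u: "r < u" "u < s" "k s - k r = (s - r) * ((g u - g r) / (1 - u\<^sup>2))"
      using mvt[of r s] r by auto
    have "g r \<le> g u" using u r by (intro mono_onD[OF mono]) auto
    then have "0 \<le> k s - k r" unfolding u(3) using u r u2[of u] by simp
    moreover have "0 < k s - k r" if "strict_mono_on {0..<1} g"
    proof -
      have "g r < g u" using u r by (intro strict_mono_onD[OF that]) auto
      then show ?thesis unfolding u(3) using u r u2[of u] by simp
    qed
    ultimately show ?thesis by auto
  next
    case 3
    then obtain u where u: "s < u" "u < r" "k r - k s = (r - s) * ((g u - g r) / (1 - u\<^sup>2))"
      using mvt[of s r] r by auto
    have "g u \<le> g r" using u r by (intro mono_onD[OF mono]) auto
    then have "k r - k s \<le> 0" unfolding u(3) using u r u2[of u]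
      by (intro mult_nonneg_nonpos divide_nonpos_pos) auto
    moreover have "k r - k s < 0" if "strict_mono_on {0..<1} g"
    proof -
      have "g u < g r" using u r by (intro strict_mono_onD[OF that]) auto
      then show ?thesis unfolding u(3) using u r u2[of u]
        by (intro mult_pos_neg divide_neg_pos) auto
    qed
    ultimately show ?thesis by auto
  qed auto
  then show "potential g r + g r * (artanh s - artanh r) \<le> potential g s"
    and "strict_mono_on {0..<1} g \<Longrightarrow> r \<noteq> s \<Longrightarrow>
      potential g r + g r * (artanh s - artanh r) < potential g s"
    by (auto simp: k_def algebra_simps)
qed

end

text \<open>\<open>G\<close> is the tangent at \<open>z\<close> in the direction of
  \<open>w\<close>. Convexity of the distance, multiplied by the slope \<open>g (norm z)\<close>, is
  chained with convexity of the potential in artanh; strictness of either link suffices.\<close>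

lemma (in radial_profile) potential_mobius_ge:
  fixes w z :: "real^'n"
  assumes mono: "mono_on {0..<1} g" and pos: "\<And>r. r \<in> {0<..<1} \<Longrightarrow> 0 < g r"
    and w: "norm w < 1" "w \<noteq> 0" and z: "norm z < 1"
  defines "G \<equiv> potential g (norm z) + artanh (norm w) / norm w * (w \<bullet> radial_field g z)"
  shows "G \<le> potential g (norm (mobius w z))"
    and "strict_mono_on {0..<1} g \<or> \<not> collinear {0, w, z} \<Longrightarrow> G < potential g (norm (mobius w z))"
proof -
  have "G \<le> potential g (norm (mobius w z)) \<and>
    (strict_mono_on {0..<1} g \<or> \<not> collinear {0, w, z} \<longrightarrow> G < potential g (norm (mobius w z)))"
  proof (cases "z = 0")
    case True
    then show ?thesis
      using potential_tangent[OF mono, of 0 "norm w"] w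
      by (auto simp: G_def radial_field_def g0 collinear_lemma)
  next
    case False
    define c where "c = w \<bullet> z / (norm w * norm z)"
    define r where "r = norm z"
    define s where "s = norm (mobius w z)"
    have rs: "r \<in> {0..<1}" "s \<in> {0..<1}" using norm_mobius_lt[of w z] w z by (auto simp: r_def s_def)
    have gr: "0 < g r" using pos False z by (auto simp: r_def)
    have G: "G = potential g r + g r * (c * artanh (norm w))"
      using False w by (simp add: G_def radial_field_def c_def r_def divide_inverse mult_ac)
    note le = artanh_norm_mobius_ge(1)[OF w z False, folded c_def r_def s_def]
    have lt: "c * artanh (norm w) < artanh s - artanh r" if "\<bar>c\<bar> < 1"
      using artanh_norm_mobius_ge(2)[OF w z False, folded c_def r_def s_def] that by simp
    have c1: "\<bar>c\<bar> < 1" if "\<not> collinear {0, w, z}"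
      using that norm_cauchy_schwarz_equal[of w z] Cauchy_Schwarz_ineq2[of w z] w False
      by (simp add: c_def abs_mult)
    have aw: "0 < artanh (norm w)" using artanh_pos w by simp
    have le': "g r * (c * artanh (norm w)) \<le> g r * (artanh s - artanh r)"
      using le gr by (intro mult_left_mono) auto
    have lt': "g r * (c * artanh (norm w)) < g r * (artanh s - artanh r)" if "\<bar>c\<bar> < 1"
      using lt[OF that] gr by (intro mult_strict_left_mono) auto
    have *: "G < potential g s" if sm: "strict_mono_on {0..<1} g"
    proof (cases "r = s")
      \<comment> \<open>The potential inequality is an equality here, so the gain must come from the
        direction. \<open>c = 1\<close> would force \<open>artanh (norm w)\<close> to be
        nonpositive, for \<open>c = -1\<close> the tangent strictly descends, and otherwise the law
        of cosines is strict.\<close>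
      case True
      have "\<bar>c\<bar> \<le> 1"
        using Cauchy_Schwarz_ineq2[of w z] w False by (simp add: c_def abs_mult)
      moreover have "c \<noteq> 1" using le aw True by auto
      moreover have "c = -1 \<Longrightarrow> G < potential g s" using True gr aw by (simp add: G mult_less_0_iff)
      ultimately consider "\<bar>c\<bar> < 1" | "G < potential g s" by fastforce
      then show ?thesis
        using lt' potential_tangent(1)[OF mono rs] by cases (auto simp: G)
    next
      case False
      then show ?thesis using potential_tangent(2)[OF mono rs sm] le' by (simp add: G)
    qed
    show ?thesis
      using potential_tangent(1)[OF mono rs] le' lt' c1 * unfolding G s_def[symmetric] by force
  qed
  then show "G \<le> potential g (norm (mobius w z))"
    and "strict_mono_on {0..<1} g \<or> \<not> collinear {0, w, z} \<Longrightarrow> G < potential g (norm (mobius w z))"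
    by auto
qed

subsection \<open>The fold map\<close>

text \<open>The \<open>max\<close> form makes continuity across the hyperplane evident, which the
  case distinction in \<open>fold_map\<close> hides.\<close>

definition halfspace_fold :: "real^'n \<Rightarrow> real^'n \<Rightarrow> real^'n" where
  "halfspace_fold p z = z - (2 * max (z \<bullet> p) 0) *\<^sub>R p"

lemma norm_reflect:
  assumes "norm p = 1"
  shows "norm (reflect p z) = norm z"
proof -
  have "p \<bullet> p = 1" using assms by (simp add: norm_eq_1)
  then have "(norm (reflect p z))\<^sup>2 = (norm z)\<^sup>2"
    by (simp add: reflect_def power2_norm_eq_inner inner_diff_left inner_diff_right inner_commute[of p z])
  then show ?thesis by simp
qed

lemma reflect_reflect:
  assumes "norm p = 1"
  shows "reflect p (reflect p z) = z"
proof -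
  have "p \<bullet> p = 1" using assms by (simp add: norm_eq_1)
  then show ?thesis by (simp add: reflect_def inner_diff_left algebra_simps)
qed

lemma halfspace_fold_eq: "halfspace_fold p z = (if z \<bullet> p \<le> 0 then z else reflect p z)"
  by (simp add: halfspace_fold_def reflect_def)

lemma norm_halfspace_fold: "norm p = 1 \<Longrightarrow> norm (halfspace_fold p z) = norm z"
  by (simp add: halfspace_fold_eq norm_reflect)

context
  fixes p :: "real^'n" and t :: real
  assumes p: "norm p = 1" and t: "\<bar>t\<bar> < 1"
begin

lemma norm_scale_lt: "norm (t *\<^sub>R p) < 1" using p t by simp

lemma mobius_scale_inverse:
  "norm y \<le> 1 \<Longrightarrow> mobius (- (t *\<^sub>R p)) (mobius (t *\<^sub>R p) y) = y"
  "norm y \<le> 1 \<Longrightarrow> mobius (t *\<^sub>R p) (mobius (- (t *\<^sub>R p)) y) = y"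
  using mobius_inverse[OF norm_scale_lt] mobius_inverse'[OF norm_scale_lt] by blast+

lemma norm_mobius_scale_lt:
  "norm y < 1 \<Longrightarrow> norm (mobius (t *\<^sub>R p) y) < 1"
  "norm y < 1 \<Longrightarrow> norm (mobius (- (t *\<^sub>R p)) y) < 1"
  using norm_mobius_lt[of "t *\<^sub>R p" y] norm_mobius_lt[of "- (t *\<^sub>R p)" y] norm_scale_lt by auto

text \<open>Conjugation by the Moebius map turns the hyperbolic fold into a Euclidean one:
  membership in the halfball becomes a sign condition on the preimage, and \<open>inv_into\<close>
  becomes the map for \<open>- (t *\<^sub>R p)\<close>.\<close>

lemma fold_map_eq:
  assumes y: "norm y < 1"
  shows "fold_map p t y = mobius (t *\<^sub>R p) (halfspace_fold p (mobius (- (t *\<^sub>R p)) y))"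
proof -
  let ?z = "mobius (- (t *\<^sub>R p)) y"
  have Tz: "mobius (t *\<^sub>R p) ?z = y" using mobius_scale_inverse y by simp
  have z1: "norm ?z < 1" using norm_mobius_scale_lt y by blast
  have half: "y \<in> halfball p t \<longleftrightarrow> ?z \<bullet> p \<le> 0"
  proof
    assume "y \<in> halfball p t"
    then show "?z \<bullet> p \<le> 0"
      by (auto simp: halfball_def mobius_scale_inverse)
  next
    assume "?z \<bullet> p \<le> 0"
    then show "y \<in> halfball p t"
      unfolding halfball_def using Tz z1 by (intro image_eqI[of _ _ ?z]) auto
  qed
  have "inj_on (mobius (t *\<^sub>R p)) (cball 0 1)"
    by (rule inj_on_inverseI[of _ "mobius (- (t *\<^sub>R p))"]) (simp add: mobius_scale_inverse)
  then have "inv_into (cball 0 1) (mobius (t *\<^sub>R p)) y = ?z"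
    by (rule inv_into_f_eq) (use Tz z1 in auto)
  then show ?thesis
    using half Tz by (simp add: fold_map_def hyp_reflect_def halfspace_fold_eq)
qed

lemma norm_fold_map_lt: "norm y < 1 \<Longrightarrow> norm (fold_map p t y) < 1"
  by (simp add: fold_map_eq norm_mobius_scale_lt norm_halfspace_fold p)

end

section \<open>Null sets and joint continuity of the fold\<close>

lemma negligible_mobius_image:
  fixes x :: "real^'n"
  assumes "norm x < 1" "negligible N" "N \<subseteq> ball 0 1"
  shows "negligible (mobius x ` N)"
proof (rule negligible_differentiable_image_negligible)
  show "mobius x differentiable_on N"
    by (rule differentiable_at_imp_differentiable_on, rule differentiable_mobius_right) (use assms in auto)
qed (use assms in auto)

text \<open>A point is either fixed or reflected, and the reflection is an involution; hence the
  preimage is covered by \<open>N\<close> and its mirror image, both null.\<close>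

lemma negligible_vimage_fold_map:
  fixes p :: "real^'n"
  assumes p: "norm p = 1" and t: "\<bar>t\<bar> < 1" and N: "negligible N" "N \<subseteq> ball 0 1"
  shows "negligible {y \<in> ball 0 1. fold_map p t y \<in> N}"
proof (rule negligible_subset)
  let ?T = "mobius (t *\<^sub>R p)" and ?T' = "mobius (- (t *\<^sub>R p))"
  have tp: "norm (t *\<^sub>R p) < 1" "norm (- (t *\<^sub>R p)) < 1" using p t by auto
  have ball: "?T' ` N \<subseteq> ball 0 1" "reflect p ` ?T' ` N \<subseteq> ball 0 1"
    using N norm_mobius_lt[OF tp(2)] by (auto simp: norm_reflect[OF p])
  have "negligible (?T' ` N)" by (rule negligible_mobius_image[OF tp(2) N])
  then have "negligible (reflect p ` ?T' ` N)"
    by (rule negligible_differentiable_image_negligible[rotated])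
       (auto simp: reflect_def inner_add_left algebra_simps intro!: linear_imp_differentiable_on linearI)
  then have "negligible (?T ` reflect p ` ?T' ` N)"
    by (rule negligible_mobius_image[OF tp(1) _ ball(2)])
  then show "negligible (N \<union> ?T ` reflect p ` ?T' ` N)"
    using N by simp
  show "{y \<in> ball 0 1. fold_map p t y \<in> N} \<subseteq> N \<union> ?T ` reflect p ` ?T' ` N"
  proof clarsimp
    fix y assume y: "norm y < 1" "fold_map p t y \<in> N" "y \<notin> ?T ` reflect p ` ?T' ` N"
    define z where "z = ?T' y"
    have Tz: "?T z = y" using mobius_inverse'[OF tp(1)] y by (simp add: z_def)
    have z: "norm z < 1" using norm_mobius_lt[OF tp(2)] y by (simp add: z_def)
    show "y \<in> N"
    proof (cases "z \<bullet> p \<le> 0")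
      case True
      then show ?thesis using y Tz fold_map_eq[OF p t y(1)] by (simp add: halfspace_fold_eq z_def)
    next
      case False
      then have F: "fold_map p t y = ?T (reflect p z)"
        using fold_map_eq[OF p t y(1)] by (simp add: halfspace_fold_eq z_def)
      have "reflect p (?T' (fold_map p t y)) = z"
        unfolding F using mobius_inverse[OF tp(1)] z by (simp add: norm_reflect[OF p] reflect_reflect[OF p])
      then show ?thesis using Tz y by (metis imageI)
    qed
  qed
qed

text \<open>Collinearity puts the image point on the line spanned by \<open>w\<close>, a null set
  from dimension two on, which is then pulled back through the Moebius map and the fold.\<close>

lemma negligible_collinear_mobius_fold_map:
  fixes p x w :: "real^'n"
  assumes n: "2 \<le> CARD('n)" and p: "norm p = 1" and t: "\<bar>t\<bar> < 1" and x: "norm x < 1" and w: "w \<noteq> 0"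
  shows "negligible {y \<in> ball 0 1. collinear {0, w, mobius x (fold_map p t y)}}"
proof (rule negligible_subset)
  have "dim (span {w}) < DIM(real^'n)"
    using n dim_le_card'[of "{w}"] by simp
  then have "negligible (span {w} \<inter> ball 0 1)"
    by (rule negligible_subset[OF negligible_lowdim]) auto
  then have "negligible (mobius (- x) ` (span {w} \<inter> ball 0 1))"
    by (rule negligible_mobius_image[rotated]) (use x in auto)
  then show "negligible {y \<in> ball 0 1. fold_map p t y \<in> mobius (- x) ` (span {w} \<inter> ball 0 1)}"
  proof (rule negligible_vimage_fold_map[OF p t])
    show "mobius (- x) ` (span {w} \<inter> ball 0 1) \<subseteq> ball 0 1"
      using x by (auto intro!: norm_mobius_lt)
  qed
  show "{y \<in> ball 0 1. collinear {0, w, mobius x (fold_map p t y)}}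
     \<subseteq> {y \<in> ball 0 1. fold_map p t y \<in> mobius (- x) ` (span {w} \<inter> ball 0 1)}"
  proof clarsimp
    fix y assume y: "norm y < 1" "collinear {0, w, mobius x (fold_map p t y)}"
    define z where "z = mobius x (fold_map p t y)"
    have F: "norm (fold_map p t y) < 1" by (rule norm_fold_map_lt[OF p t y(1)])
    have "z \<in> span {w}"
      using y(2) w unfolding z_def[symmetric] collinear_lemma by (auto intro: span_zero span_base span_scale)
    moreover have "norm z < 1" "fold_map p t y = mobius (- x) z"
      using F norm_mobius_lt[OF x] mobius_inverse[OF x] by (auto simp: z_def)
    ultimately show "fold_map p t y \<in> mobius (- x) ` (span {w} \<inter> ball 0 1)" by auto
  qed
qed

lemma continuous_on_fold_map:
  "continuous_on ((sphere 0 1 \<times> {-1<..<1}) \<times> ball 0 1) (\<lambda>((p, t), y :: real^'n). fold_map p t y)"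
proof -
  let ?P = "(sphere 0 1 \<times> {-1<..<1}) \<times> ball 0 1 :: (((real^'n) \<times> real) \<times> (real^'n)) set"
  let ?x = "\<lambda>s :: ((real^'n) \<times> real) \<times> (real^'n). snd (fst s) *\<^sub>R fst (fst s)"
  let ?z = "\<lambda>s. mobius (- ?x s) (snd s)"
  have x: "continuous_on ?P ?x" by (intro continuous_intros)
  have x1: "norm (?x s) < 1" if "s \<in> ?P" for s
    using that by (auto simp: mem_Times_iff abs_less_iff)
  have z: "continuous_on ?P ?z"
    by (rule continuous_on_mobius)
       (use x1 in \<open>auto intro!: continuous_on_minus x continuous_on_snd continuous_on_id simp: less_imp_le\<close>)
  have z1: "norm (?z s) < 1" if "s \<in> ?P" for s
    using that x1[OF that] by (intro norm_mobius_lt) auto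
  have f: "continuous_on ?P (\<lambda>s. halfspace_fold (fst (fst s)) (?z s))"
    unfolding halfspace_fold_def by (intro continuous_intros z)
  have f1: "norm (halfspace_fold (fst (fst s)) (?z s)) \<le> 1" if "s \<in> ?P" for s
    using z1[OF that] that by (subst norm_halfspace_fold) auto
  have "continuous_on ?P (\<lambda>s. mobius (?x s) (halfspace_fold (fst (fst s)) (?z s)))"
    by (rule continuous_on_mobius[OF x f x1 f1])
  then show ?thesis
    by (rule continuous_on_cong[THEN iffD1, rotated -1]) (auto simp: fold_map_eq)
qed

subsection \<open>Weighted energy\<close>

text \<open>\<open>W\<close> stands for the density of the measure, extended by zero, and need only
  be integrable. All regularity is asked of the other factor, and only on the compact set
  \<open>C\<close>, where continuity yields bounds for dominated convergence.\<close>

locale ball_weight =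
  fixes W :: "real^'n \<Rightarrow> real" and C :: "(real^'n) set"
  assumes C: "compact C" "C \<subseteq> ball 0 1"
    and W_int: "integrable lebesgue W"
    and W_nonneg: "\<And>y. 0 \<le> W y"
    and W_supp: "\<And>y. y \<notin> C \<Longrightarrow> W y = 0"
    and W_pos: "0 < (LINT y|lebesgue. W y)"
begin

lemma borel_measurable_weighted:
  fixes k :: "real^'n \<Rightarrow> 'b::euclidean_space"
  assumes "continuous_on C k"
  shows "(\<lambda>y. W y *\<^sub>R k y) \<in> borel_measurable lebesgue"
proof -
  have "C \<in> sets borel" using C by (simp add: borel_compact)
  then have "(\<lambda>y. indicator C y *\<^sub>R k y) \<in> borel_measurable borel"
    using assms by (rule borel_measurable_continuous_on_indicator)
  then have "(\<lambda>y. indicator C y *\<^sub>R k y) \<in> borel_measurable lebesgue"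
    by (intro measurable_completion) simp
  then have "(\<lambda>y. W y *\<^sub>R (indicator C y *\<^sub>R k y)) \<in> borel_measurable lebesgue"
    by (rule borel_measurable_scaleR[OF borel_measurable_integrable[OF W_int]])
  moreover have "(\<lambda>y. W y *\<^sub>R (indicator C y *\<^sub>R k y)) = (\<lambda>y. W y *\<^sub>R k y)"
    using W_supp by (auto simp: fun_eq_iff indicator_def)
  ultimately show ?thesis by simp
qed

lemma norm_weighted_le:
  assumes "y \<in> C \<Longrightarrow> norm (k y) \<le> B"
  shows "norm (W y *\<^sub>R k y) \<le> B * W y"
proof (cases "y \<in> C")
  case True
  then show ?thesis
    using mult_right_mono[OF assms W_nonneg, of y] W_nonneg[of y] by (simp add: mult.commute)
qed (simp add: W_supp)

lemma integrable_weighted: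
  fixes k :: "real^'n \<Rightarrow> 'b::euclidean_space"
  assumes "continuous_on C k"
  shows "integrable lebesgue (\<lambda>y. W y *\<^sub>R k y)"
proof -
  obtain B where B: "\<And>y. y \<in> C \<Longrightarrow> norm (k y) \<le> B"
    using compact_imp_bounded[OF compact_continuous_image[OF assms C(1)]] by (auto simp: bounded_iff)
  show ?thesis
  proof (rule Bochner_Integration.integrable_bound)
    show "integrable lebesgue (\<lambda>y. B * W y)" using W_int by simp
    show "AE y in lebesgue. norm (W y *\<^sub>R k y) \<le> norm (B * W y)"
      using norm_weighted_le[OF B] by (auto intro!: always_eventually order.trans[OF _ abs_ge_self])
  qed (rule borel_measurable_weighted[OF assms])
qed

lemma tendsto_weighted_integral:
  fixes k :: "nat \<Rightarrow> real^'n \<Rightarrow> 'b::euclidean_space"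
  assumes "\<And>i. continuous_on C (k i)" "continuous_on C l"
    and "\<And>i y. y \<in> C \<Longrightarrow> norm (k i y) \<le> B"
    and "\<And>y. y \<in> C \<Longrightarrow> (\<lambda>i. k i y) \<longlonglongrightarrow> l y"
  shows "(\<lambda>i. LINT y|lebesgue. W y *\<^sub>R k i y) \<longlonglongrightarrow> (LINT y|lebesgue. W y *\<^sub>R l y)"
proof (rule integral_dominated_convergence)
  show "integrable lebesgue (\<lambda>y. B * W y)" using W_int by simp
  show "AE y in lebesgue. (\<lambda>i. W y *\<^sub>R k i y) \<longlonglongrightarrow> W y *\<^sub>R l y"
  proof (intro always_eventually allI)
    show "(\<lambda>i. W y *\<^sub>R k i y) \<longlonglongrightarrow> W y *\<^sub>R l y" for y
      using assms(4)[of y] W_supp[of y] by (cases "y \<in> C") (auto intro: tendsto_intros)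
  qed
  show "AE y in lebesgue. norm (W y *\<^sub>R k i y) \<le> B * W y" for i
    using norm_weighted_le assms(3) by blast
qed (auto intro!: assms(1,2) borel_measurable_weighted simp del: real_scaleR_def)

lemma continuous_on_weighted_integral:
  fixes k :: "'a::heine_borel \<Rightarrow> real^'n \<Rightarrow> 'b::euclidean_space"
  assumes k: "continuous_on (S \<times> C) (\<lambda>(s, y). k s y)"
  shows "continuous_on S (\<lambda>s. LINT y|lebesgue. W y *\<^sub>R k s y)"
  unfolding continuous_on_sequentially
proof (intro allI ballI impI, elim conjE)
  fix x l assume l: "l \<in> S" and x: "\<forall>n. x n \<in> S" "x \<longlonglongrightarrow> l"
  let ?K = "insert l (range x)"
  have K: "?K \<subseteq> S" using l x by auto
  \<comment> \<open>\<open>S\<close> need not be compact; a convergent sequence together with its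
    limit is, and this supplies one dominating constant.\<close>
  have "compact (?K \<times> C)"
    using compact_sequence_with_limit[OF x(2)] C by (intro compact_Times)
  moreover have "continuous_on (?K \<times> C) (\<lambda>(s, y). k s y)"
    by (rule continuous_on_subset[OF k]) (use K in auto)
  ultimately have "bounded ((\<lambda>(s, y). k s y) ` (?K \<times> C))"
    by (intro compact_imp_bounded compact_continuous_image)
  then obtain B where B: "\<And>s y. s \<in> ?K \<Longrightarrow> y \<in> C \<Longrightarrow> norm (k s y) \<le> B"
    by (auto simp: bounded_iff)
  have cont: "continuous_on C (k s)" if "s \<in> S" for s
  proof -
    have "continuous_on C ((\<lambda>(s, y). k s y) \<circ> (\<lambda>y. (s, y)))"
      by (intro continuous_on_compose continuous_intros continuous_on_subset[OF k]) (use that in auto)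
    then show ?thesis by (simp add: o_def)
  qed
  show "((\<lambda>s. LINT y|lebesgue. W y *\<^sub>R k s y) \<circ> x) \<longlonglongrightarrow> (LINT y|lebesgue. W y *\<^sub>R k l y)"
    unfolding o_def
  proof (rule tendsto_weighted_integral)
    show "(\<lambda>i. k (x i) y) \<longlonglongrightarrow> k l y" if "y \<in> C" for y
    proof -
      have "(\<lambda>i. (x i, y)) \<longlonglongrightarrow> (l, y)" using x by (intro tendsto_intros)
      then have "((\<lambda>(s, y). k s y) \<circ> (\<lambda>i. (x i, y))) \<longlonglongrightarrow> (\<lambda>(s, y). k s y) (l, y)"
        using k[unfolded continuous_on_sequentially, rule_format, of "(l, y)" "\<lambda>i. (x i, y)"] l x that by auto
      then show ?thesis by (simp add: o_def)
    qed
  qed (use B cont l x in auto)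
qed

end

locale weighted_energy = radial_profile g + ball_weight W C
  for g :: "real \<Rightarrow> real" and W :: "real^'n \<Rightarrow> real" and C :: "(real^'n) set" +
  assumes g_div: "filterlim (potential g) at_top (at_left 1)"
begin

text \<open>\<open>u\<close> plays the part of the fold map; keeping it arbitrary lets the estimates
  be uniform over a family of folds.\<close>

definition energy :: "(real^'n \<Rightarrow> real^'n) \<Rightarrow> real^'n \<Rightarrow> real" where
  "energy u x = (LINT y|lebesgue. W y *\<^sub>R potential g (norm (mobius x (u y))))"

definition moment :: "(real^'n \<Rightarrow> real^'n) \<Rightarrow> real^'n \<Rightarrow> real^'n" where
  "moment u x = (LINT y|lebesgue. W y *\<^sub>R radial_field g (mobius x (u y)))"

lemma continuous_on_potential_mobius:
  assumes "continuous_on S a" "continuous_on S b"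
    and "\<And>s. s \<in> S \<Longrightarrow> norm (a s) < 1" "\<And>s. s \<in> S \<Longrightarrow> norm (b s :: real^'n) < 1"
  shows "continuous_on S (\<lambda>s. potential g (norm (mobius (a s) (b s))))"
  by (rule continuous_on_compose2[OF continuous_on_potential])
     (use assms in \<open>auto intro!: continuous_intros norm_mobius_lt simp: less_imp_le\<close>)

lemma continuous_on_field_mobius:
  assumes "continuous_on S a" "continuous_on S b"
    and "\<And>s. s \<in> S \<Longrightarrow> norm (a s) < 1" "\<And>s. s \<in> S \<Longrightarrow> norm (b s :: real^'n) < 1"
  shows "continuous_on S (\<lambda>s. radial_field g (mobius (a s) (b s)))"
  by (rule continuous_on_compose2[OF continuous_on_radial_field])
     (use assms in \<open>auto intro!: continuous_intros norm_mobius_lt simp: less_imp_le\<close>)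

lemma continuous_on_energy:
  fixes u :: "'a::heine_borel \<Rightarrow> real^'n \<Rightarrow> real^'n"
  assumes "continuous_on (Q \<times> C) (\<lambda>(q, y). u q y)" "\<And>q y. q \<in> Q \<Longrightarrow> y \<in> C \<Longrightarrow> norm (u q y) < 1"
  shows "continuous_on (Q \<times> ball 0 1) (\<lambda>(q, x). energy (u q) x)"
proof -
  have "continuous_on ((Q \<times> ball 0 1) \<times> C) (\<lambda>s. (\<lambda>(q, y). u q y) (fst (fst s), snd s))"
    by (rule continuous_on_compose2[OF assms(1)]) (auto intro!: continuous_intros)
  then have "continuous_on ((Q \<times> ball 0 1) \<times> C) (\<lambda>s. potential g (norm (mobius (snd (fst s)) (u (fst (fst s)) (snd s)))))"
    by (intro continuous_on_potential_mobius) (use assms(2) in \<open>auto intro!: continuous_intros\<close>)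
  then have "continuous_on (Q \<times> ball 0 1) (\<lambda>s. LINT y|lebesgue. W y *\<^sub>R potential g (norm (mobius (snd s) (u (fst s) y))))"
    by (intro continuous_on_weighted_integral) (simp add: case_prod_unfold)
  then show ?thesis by (simp add: energy_def case_prod_unfold)
qed

text \<open>The radius depends only on \<open>A\<close>, not on \<open>u\<close>: this confines the
  minimizers of a whole family to one compact ball. The comparison point is the origin because
  \<open>mobius 0\<close> is the identity.\<close>

lemma energy_coercive:
  assumes A: "compact A" "A \<subseteq> ball 0 1"
  obtains r where "0 < r" "r < 1"
    "\<And>u x. continuous_on C u \<Longrightarrow> u ` C \<subseteq> A \<Longrightarrow> r < norm x \<Longrightarrow> norm x < 1 \<Longrightarrow> energy u 0 < energy u x"
proof -
  obtain b where b: "0 \<le> b" "b < 1" "\<And>z. z \<in> A \<Longrightarrow> norm z \<le> b"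
  proof (cases "A = {}")
    case False
    obtain z where "z \<in> A" "\<forall>y\<in>A. norm y \<le> norm z"
      using continuous_attains_sup[OF A(1) False continuous_on_norm_id] by auto
    then show thesis using A(2) by (intro that[of "norm z"]) auto
  qed (use that[of 0] in auto)
  have "continuous_on {0..b} (potential g)"
    by (rule continuous_on_subset[OF continuous_on_potential]) (use b in auto)
  then obtain s where "\<forall>r\<in>{0..b}. potential g r \<le> potential g s"
    using continuous_attains_sup[of "{0..b}" "potential g"] b by auto
  then have M: "potential g r \<le> potential g s" if "0 \<le> r" "r \<le> b" for r
    using that by simp
  \<comment> \<open>\<open>M\<close> is the maximum over {0..b}, since without monotonicity of
    \<open>g\<close> the potential need not be largest at \<open>b\<close>. It gives energy at most
    M times the mass at the origin, against at least M + 1 times the mass near the sphere.\<close>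
  define M where "M = potential g s"
  note M = M[folded M_def]
  have "\<forall>\<^sub>F r in at_left 1. M + 1 \<le> potential g r"
    using g_div by (simp add: filterlim_at_top)
  then obtain a where a: "a < 1" "\<And>r. a < r \<Longrightarrow> r < 1 \<Longrightarrow> M + 1 \<le> potential g r"
    using eventually_at_left[of 0 1] by (auto simp: eventually_at_left_field)
  define a' where "a' = max a 0"
  have a': "0 \<le> a'" "a' < 1" using a by (auto simp: a'_def)
  \<comment> \<open>Chosen so that 1 - |x|^2 < \<delta> and |z| at most b force |T_x z| > a', by
    \<open>norm_mobius_sq\<close> and the lower bound (1 - b)^2 for the denominator.\<close>
  define \<delta> where "\<delta> = (1 - a'\<^sup>2) * (1 - b)\<^sup>2"
  have \<delta>: "0 < \<delta>" using a' b by (auto simp: \<delta>_def abs_square_less_1)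
  \<comment> \<open>\<delta> can equal 1; the minimum with 1/2 keeps \<open>r\<close>
    positive.\<close>
  define r where "r = sqrt (1 - min \<delta> (1/2))"
  have r: "0 < r" "r < 1" "r\<^sup>2 = 1 - min \<delta> (1/2)" using \<delta> by (auto simp: r_def)
  have far: "M + 1 \<le> potential g (norm (mobius x z))" if x: "r < norm x" "norm x < 1" and z: "norm z \<le> b" for x z :: "real^'n"
  proof -
    have "r\<^sup>2 < (norm x)\<^sup>2" using x r by (intro power_strict_mono) auto
    then have x\<delta>: "1 - (norm x)\<^sup>2 < \<delta>" using r by linarith
    have "norm x * norm z \<le> 1 * b" using x z b by (intro mult_mono) auto
    then have "(1 - b)\<^sup>2 \<le> (1 - norm x * norm z)\<^sup>2" using b by (intro power_mono) auto
    then have D: "(1 - b)\<^sup>2 \<le> mobius_denom x z" using mobius_denom_ge[of x z] by linarith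
    have b0: "0 < (1 - b)\<^sup>2" using b by simp
    have z1: "norm z < 1" using z b by linarith
    have "(1 - (norm x)\<^sup>2) * (1 - (norm z)\<^sup>2) \<le> (1 - (norm x)\<^sup>2) * 1"
      using one_minus_norm_sq_pos[OF x(2)] by (intro mult_left_mono) auto
    then have "(1 - (norm x)\<^sup>2) * (1 - (norm z)\<^sup>2) < (1 - a'\<^sup>2) * (1 - b)\<^sup>2" using x\<delta> by (simp add: \<delta>_def)
    also have "\<dots> \<le> (1 - a'\<^sup>2) * mobius_denom x z"
      using D a' by (intro mult_left_mono) (auto simp: abs_square_le_1)
    finally have "(1 - (norm x)\<^sup>2) * (1 - (norm z)\<^sup>2) / mobius_denom x z < 1 - a'\<^sup>2"
      using order.strict_trans2[OF b0 D] by (simp add: pos_divide_less_eq)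
    then have "a'\<^sup>2 < (norm (mobius x z))\<^sup>2"
      using norm_mobius_sq[of x z] x z1 by simp
    then have "a' < norm (mobius x z)" by (rule power2_less_imp_less) simp
    then show ?thesis using norm_mobius_lt[OF x(2) z1] a by (auto simp: a'_def)
  qed
  have main: "energy u 0 < energy u x" if u: "continuous_on C u" "u ` C \<subseteq> A" and x: "r < norm x" "norm x < 1" for u x
  proof -
    have u1: "norm (u y) \<le> b" "norm (u y) < 1" if "y \<in> C" for y
    proof -
      have "u y \<in> A" using u(2) that by auto
      then show "norm (u y) \<le> b" by (rule b(3))
      then show "norm (u y) < 1" using b(2) by linarith
    qed
    have int: "integrable lebesgue (\<lambda>y. W y *\<^sub>R potential g (norm (mobius x (u y))))" if "norm x < 1" for x
      by (rule integrable_weighted[OF continuous_on_potential_mobius[OF continuous_on_const u(1)]]) (use that u1 in auto)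
    have "energy u 0 \<le> (LINT y|lebesgue. M * W y)"
      unfolding energy_def
    proof (rule integral_mono)
      show "W y *\<^sub>R potential g (norm (mobius 0 (u y))) \<le> M * W y" for y
      proof (cases "y \<in> C")
        case True
        then show ?thesis
          using mult_left_mono[OF M[of "norm (u y)"] W_nonneg[of y]] u1 by (simp add: mult.commute)
      qed (simp add: W_supp)
    qed (use int[of 0] W_int in auto)
    also have "\<dots> < (LINT y|lebesgue. (M + 1) * W y)"
      using W_pos by simp
    also have "\<dots> \<le> energy u x"
      unfolding energy_def
    proof (rule integral_mono)
      show "(M + 1) * W y \<le> W y *\<^sub>R potential g (norm (mobius x (u y)))" for y
      proof (cases "y \<in> C")
        case True
        then show ?thesis
          using mult_left_mono[OF far[OF x, of "u y"] W_nonneg[of y]] u1 by (simp add: mult.commute)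
      qed (simp add: W_supp)
    qed (use int[of x] x W_int in auto)
    finally show ?thesis .
  qed
  show thesis by (rule that[OF r(1,2) main])
qed

lemma energy_minimizer_ex:
  assumes u: "continuous_on C u" "u ` C \<subseteq> ball 0 1"
  obtains x where "norm x < 1" "\<And>x'. norm x' < 1 \<Longrightarrow> energy u x \<le> energy u x'"
proof -
  obtain r where r: "0 < r" "r < 1" "\<And>x. r < norm x \<Longrightarrow> norm x < 1 \<Longrightarrow> energy u 0 < energy u x"
    by (rule energy_coercive[OF compact_continuous_image[OF u(1) C(1)] u(2)]) (auto intro: u(1))
  \<comment> \<open>The real parameter is a dummy that specializes joint continuity to a single
    \<open>u\<close>.\<close>
  have "continuous_on (UNIV \<times> ball 0 1) (\<lambda>(q :: real, x). energy u x)"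
  proof (rule continuous_on_energy)
    show "continuous_on (UNIV \<times> C) (\<lambda>(q :: real, y). u y)"
      unfolding case_prod_unfold by (rule continuous_on_compose2[OF u(1)]) (auto intro!: continuous_intros)
  qed (use u in auto)
  then have "continuous_on (cball 0 r) (\<lambda>x. (\<lambda>(q :: real, x). energy u x) (0, x))"
    by (rule continuous_on_compose2) (use r in \<open>auto intro!: continuous_intros\<close>)
  then have "continuous_on (cball 0 r) (energy u)" by simp
  then obtain x where x: "x \<in> cball 0 r" "\<forall>y\<in>cball 0 r. energy u x \<le> energy u y"
    using continuous_attains_inf[of "cball 0 r" "energy u"] r by auto
  show thesis
  proof (rule that[of x])
    show "energy u x \<le> energy u x'" if "norm x' < 1" for x'
    proof (cases "norm x' \<le> r")
      case False
      then have "energy u 0 < energy u x'" using r that by simp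
      moreover have "energy u x \<le> energy u 0" using x r by simp
      ultimately show ?thesis by simp
    qed (use x in simp)
  qed (use x r in auto)
qed

end

section \<open>Critical points, uniqueness and stability of minimizers\<close>

context weighted_energy
begin

lemma integrable_potential:
  fixes u :: "real^'n \<Rightarrow> real^'n"
  assumes "continuous_on C u" "u ` C \<subseteq> ball 0 1" "norm x < 1"
  shows "integrable lebesgue (\<lambda>y. W y *\<^sub>R potential g (norm (mobius x (u y))))"
  by (rule integrable_weighted[OF continuous_on_potential_mobius[OF continuous_on_const assms(1)]])
     (use assms in auto)

lemma integrable_field:
  fixes u :: "real^'n \<Rightarrow> real^'n"
  assumes "continuous_on C u" "u ` C \<subseteq> ball 0 1" "norm x < 1"
  shows "integrable lebesgue (\<lambda>y. W y *\<^sub>R radial_field g (mobius x (u y)))"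
  by (rule integrable_weighted[OF continuous_on_field_mobius[OF continuous_on_const assms(1)]])
     (use assms in auto)

lemma moment_inner:
  fixes u :: "real^'n \<Rightarrow> real^'n"
  assumes "continuous_on C u" "u ` C \<subseteq> ball 0 1" "norm x < 1"
  shows "(LINT y|lebesgue. W y *\<^sub>R (radial_field g (mobius x (u y)) \<bullet> e)) = moment u x \<bullet> e"
    and "integrable lebesgue (\<lambda>y. W y *\<^sub>R (radial_field g (mobius x (u y)) \<bullet> e))"
proof -
  note int = integrable_field[OF assms]
  show "(LINT y|lebesgue. W y *\<^sub>R (radial_field g (mobius x (u y)) \<bullet> e)) = moment u x \<bullet> e"
    unfolding moment_def using integral_inner_left[of e, OF int] by simp
  show "integrable lebesgue (\<lambda>y. W y *\<^sub>R (radial_field g (mobius x (u y)) \<bullet> e))"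
    using integrable_inner_left[of e, OF int] by simp
qed

lemma has_derivative_imp_tendsto_quotient:
  fixes F :: "'a::real_normed_vector \<Rightarrow> real"
  assumes F: "(F has_derivative F') (at x)" and h: "h \<longlonglongrightarrow> 0" "\<And>i. h i \<noteq> 0"
  shows "(\<lambda>i. (F (x + h i *\<^sub>R e) - F x) / h i) \<longlonglongrightarrow> F' e"
proof -
  have "((\<lambda>s. x + s *\<^sub>R e) has_derivative (\<lambda>s. s *\<^sub>R e)) (at (0 :: real))"
    by (auto intro!: derivative_eq_intros)
  from diff_chain_at[OF this, of F F'] F
  have "((\<lambda>s. F (x + s *\<^sub>R e)) has_derivative (\<lambda>s. F' (s *\<^sub>R e))) (at 0)"
    by (simp add: o_def)
  moreover have "(\<lambda>s. F' (s *\<^sub>R e)) = (*) (F' e)"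
    using linear_scale[OF has_derivative_linear[OF F]] by (auto simp: fun_eq_iff)
  ultimately have "((\<lambda>s. F (x + s *\<^sub>R e)) has_real_derivative F' e) (at 0)"
    by (simp add: has_field_derivative_def)
  then have "((\<lambda>s. (F (x + s *\<^sub>R e) - F x) / s) \<longlongrightarrow> F' e) (at 0)"
    by (simp add: DERIV_def)
  then show ?thesis
    by (rule filterlim_compose) (use h in \<open>simp add: filterlim_at\<close>)
qed

text \<open>One direction suffices. The derivative of the energy along \<open>e\<close> is the inner
  product of the moment with \<open>e\<close>, divided by 1 - |x|^2; at a minimum it is nonnegative,
  and \<open>e = - moment u x\<close> makes it nonpositive.\<close>

lemma moment_minimizer:
  assumes u: "continuous_on C u" "u ` C \<subseteq> ball 0 1" and x: "norm x < 1"
    and min: "\<And>x'. norm x' < 1 \<Longrightarrow> energy u x \<le> energy u x'"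
  shows "moment u x = 0"
proof -
  define e where "e = - moment u x"
  obtain \<delta> where \<delta>: "0 < \<delta>" "cball x \<delta> \<subseteq> ball 0 1"
  proof -
    have "x \<in> ball 0 1" using x by simp
    then show ?thesis
      using that open_ball[of "0 :: real^'n" 1] unfolding open_contains_cball by blast
  qed
  have u1: "norm (u y) < 1" if "y \<in> C" for y using u(2) that by auto
  \<comment> \<open>The gradient of the integrand. Its bound on a compact neighbourhood dominates
    the difference quotients through the mean value inequality.\<close>
  define V where "V = (\<lambda>(z, y). radial_field g (mobius z (u y)) /\<^sub>R (1 - (norm z)\<^sup>2))"
  have "continuous_on (cball x \<delta> \<times> C) V"
    unfolding V_def case_prod_unfold
  proof (intro continuous_on_scaleR continuous_on_field_mobius continuous_on_inverse)
    show "continuous_on (cball x \<delta> \<times> C) (\<lambda>s. u (snd s))"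
      by (rule continuous_on_compose2[OF u(1)]) (auto intro!: continuous_intros)
    show "\<forall>s\<in>cball x \<delta> \<times> C. 1 - (norm (fst s))\<^sup>2 \<noteq> 0"
      using \<delta>(2) one_minus_norm_sq_pos by (fastforce simp: less_le)
  qed (use \<delta> u1 in \<open>auto intro!: continuous_intros\<close>)
  then have "bounded (V ` (cball x \<delta> \<times> C))"
    using C by (intro compact_imp_bounded compact_continuous_image compact_Times) auto
  then obtain B where B: "\<And>z y. z \<in> cball x \<delta> \<Longrightarrow> y \<in> C \<Longrightarrow> norm (V (z, y)) \<le> B"
    by (fastforce simp: bounded_iff)
  define P where "P = (\<lambda>z y. potential g (norm (mobius z (u y))))"
  have P': "((\<lambda>z. P z y) has_derivative (\<lambda>h. V (z, y) \<bullet> h)) (at z)" if "norm z < 1" "y \<in> C" for z y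
    using potential_mobius_has_derivative[OF that(1) u1[OF that(2)]]
    by (simp add: P_def V_def divide_inverse mult.commute)
  \<comment> \<open>Positive step sizes that keep \<open>x + h i *\<^sub>R e\<close> within \<delta>
    of \<open>x\<close>; the added 1 covers \<open>e = 0\<close>.\<close>
  define h where "h = (\<lambda>i. \<delta> / (norm e + 1) / real (Suc i))"
  have h0: "0 < h i" for i
    unfolding h_def by (intro divide_pos_pos add_nonneg_pos \<delta>) auto
  have h_lim: "h \<longlonglongrightarrow> 0"
    unfolding h_def by (rule real_tendsto_divide_at_top[OF tendsto_const])
      (rule filterlim_compose[OF filterlim_real_sequentially filterlim_Suc])
  have near: "x + h i *\<^sub>R e \<in> cball x \<delta>" for i
  proof -
    have "norm e \<le> (norm e + 1) * real (Suc i)"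
      by (simp add: algebra_simps add_nonneg_nonneg)
    then have "h i * norm e \<le> h i * ((norm e + 1) * real (Suc i))"
      using h0 by (intro mult_left_mono) (auto simp: less_imp_le)
    also have "\<dots> = \<delta>"
    proof -
      have "norm e + 1 \<noteq> 0" using norm_ge_zero[of e] by linarith
      then show ?thesis by (simp add: h_def del: of_nat_Suc)
    qed
    finally show ?thesis using h0[of i] by (simp add: dist_norm)
  qed
  have near1: "norm (x + h i *\<^sub>R e) < 1" for i using near[of i] \<delta>(2) by auto
  define k where "k = (\<lambda>i y. (P (x + h i *\<^sub>R e) y - P x y) / h i)"
  have Pc: "continuous_on C (P z)" if "norm z < 1" for z
    unfolding P_def using that u1 by (intro continuous_on_potential_mobius continuous_on_const u(1)) auto
  have "(\<lambda>i. LINT y|lebesgue. W y *\<^sub>R k i y) \<longlonglongrightarrow> (LINT y|lebesgue. W y *\<^sub>R (V (x, y) \<bullet> e))"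
  proof (rule tendsto_weighted_integral)
    show "continuous_on C (k i)" for i
      unfolding k_def using h0[of i] x near1 by (intro continuous_on_divide continuous_on_diff Pc continuous_on_const) auto
    show "continuous_on C (\<lambda>y. V (x, y) \<bullet> e)"
      unfolding V_def prod.case using x u1
      by (intro continuous_on_inner continuous_on_scaleR continuous_on_const continuous_on_field_mobius u(1)) auto
    show "norm (k i y) \<le> B * norm e" if y: "y \<in> C" for i y
    proof -
      have "norm (P (x + h i *\<^sub>R e) y - P x y) \<le> B * norm (x + h i *\<^sub>R e - x)"
      proof (rule differentiable_bound[OF convex_cball[of x \<delta>]])
        show "((\<lambda>z. P z y) has_derivative (\<lambda>h. V (z, y) \<bullet> h)) (at z within cball x \<delta>)" if "z \<in> cball x \<delta>" for z
        proof (rule has_derivative_at_withinI[OF P'[OF _ y]])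
          show "norm z < 1" using that \<delta>(2) by auto
        qed
        show "onorm (\<lambda>h. V (z, y) \<bullet> h) \<le> B" if "z \<in> cball x \<delta>" for z
        proof (rule onorm_le)
          show "norm (V (z, y) \<bullet> h) \<le> B * norm h" for h
            using Cauchy_Schwarz_ineq2[of "V (z, y)" h] mult_right_mono[OF B[OF that y], of "norm h"]
            by simp
        qed
      qed (use near \<delta> in auto)
      then show ?thesis using h0[of i] by (simp add: k_def divide_simps mult_ac)
    qed
    show "(\<lambda>i. k i y) \<longlonglongrightarrow> V (x, y) \<bullet> e" if "y \<in> C" for y
      unfolding k_def using h0
      by (intro has_derivative_imp_tendsto_quotient[OF P'[OF x that] h_lim]) (auto simp: less_imp_neq[symmetric])
  qed
  moreover have "0 \<le> (LINT y|lebesgue. W y *\<^sub>R k i y)" for i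
  proof -
    have "(LINT y|lebesgue. W y *\<^sub>R k i y) = (LINT y|lebesgue. (W y *\<^sub>R P (x + h i *\<^sub>R e) y - W y *\<^sub>R P x y) / h i)"
      by (simp add: k_def right_diff_distrib)
    also have "\<dots> = (energy u (x + h i *\<^sub>R e) - energy u x) / h i"
      unfolding P_def energy_def
      using integrable_potential[OF u near1] integrable_potential[OF u x] by simp
    finally show ?thesis using min[OF near1] h0[of i] by simp
  qed
  ultimately have "0 \<le> (LINT y|lebesgue. W y *\<^sub>R (V (x, y) \<bullet> e))"
    by (intro LIMSEQ_le_const) auto
  also have "\<dots> = (LINT y|lebesgue. (W y *\<^sub>R (radial_field g (mobius x (u y)) \<bullet> e)) / (1 - (norm x)\<^sup>2))"
    by (simp add: V_def divide_inverse mult_ac)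
  also have "\<dots> = (moment u x \<bullet> e) / (1 - (norm x)\<^sup>2)"
    using moment_inner(1)[OF u x, of e] by simp
  finally have "0 \<le> - (moment u x \<bullet> moment u x)"
    using one_minus_norm_sq_pos[OF x] by (simp add: e_def pos_divide_le_eq)
  then have "moment u x \<bullet> moment u x = 0"
    using inner_ge_zero[of "moment u x"] by linarith
  then show ?thesis by simp
qed

text \<open>The isometry taking \<open>x\<close> to the origin reduces the comparison of \<open>x\<close> and \<open>x'\<close> to the
  convexity of the energy along a geodesic through the origin.\<close>

lemma energy_less:
  assumes mono: "mono_on {0..<1} g" and pos: "\<And>r. r \<in> {0<..<1} \<Longrightarrow> 0 < g r"
    and u: "continuous_on C u" "u ` C \<subseteq> ball 0 1"
    and x: "norm x < 1" and x': "norm x' < 1" "x' \<noteq> x"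
    and zero: "moment u x = 0"
    and strict: "strict_mono_on {0..<1} g \<or>
      (\<forall>w. w \<noteq> 0 \<longrightarrow> (AE y in lebesgue. y \<in> C \<longrightarrow> \<not> collinear {0, w, mobius x (u y)}))"
  shows "energy u x < energy u x'"
proof (rule ccontr)
  assume "\<not> ?thesis"
  then have le: "energy u x' \<le> energy u x" by simp
  define w where "w = mobius (- x) x'"
  have w1: "norm w < 1" using norm_mobius_lt[of "-x" x'] x x' by (simp add: w_def)
  have w0: "w \<noteq> 0"
    using mobius_inverse'[OF x, of x'] x' by (auto simp: w_def)
  define l where "l = artanh (norm w) / norm w"
  \<comment> \<open>The gap between integrand and tangent. The vector \<open>l *\<^sub>R w\<close>
    does not depend on \<open>y\<close>, so the linear part integrates to its inner product with the
    moment, zero. If \<open>x'\<close> were no worse than \<open>x\<close>, then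
    \<open>W y * d y\<close> would vanish almost everywhere, and with it \<open>W\<close>, against
    the positive mass.\<close>
  define d where "d = (\<lambda>y. potential g (norm (mobius x' (u y))) - potential g (norm (mobius x (u y)))
     - radial_field g (mobius x (u y)) \<bullet> (l *\<^sub>R w))"
  have u1: "norm (u y) < 1" if "y \<in> C" for y using u(2) that by auto
  have ge: "0 \<le> d y" if "y \<in> C" for y
    using potential_mobius_ge(1)[OF mono pos w1 w0 norm_mobius_lt[OF x u1[OF that]]]
      norm_mobius_cocycle[OF x x'(1) u1[OF that]]
    by (simp add: d_def l_def w_def[symmetric] inner_commute)
  have gt: "0 < d y" if "y \<in> C" "strict_mono_on {0..<1} g \<or> \<not> collinear {0, w, mobius x (u y)}" for y
    using potential_mobius_ge(2)[OF mono pos w1 w0 norm_mobius_lt[OF x u1[OF that(1)]] that(2)]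
      norm_mobius_cocycle[OF x x'(1) u1[OF that(1)]]
    by (simp add: d_def l_def w_def[symmetric] inner_commute)
  have AE_gt: "AE y in lebesgue. y \<in> C \<longrightarrow> 0 < d y"
    using strict
  proof
    assume "\<forall>w. w \<noteq> 0 \<longrightarrow> (AE y in lebesgue. y \<in> C \<longrightarrow> \<not> collinear {0, w, mobius x (u y)})"
    then have "AE y in lebesgue. y \<in> C \<longrightarrow> \<not> collinear {0, w, mobius x (u y)}" using w0 by blast
    then show ?thesis by eventually_elim (use gt in blast)
  qed (use gt in blast)
  have Wd: "W y * d y = W y *\<^sub>R potential g (norm (mobius x' (u y))) - W y *\<^sub>R potential g (norm (mobius x (u y)))
     - W y *\<^sub>R (radial_field g (mobius x (u y)) \<bullet> (l *\<^sub>R w))" for y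
    by (simp add: d_def algebra_simps)
  note ints = integrable_potential[OF u x'(1)] integrable_potential[OF u x] moment_inner(2)[OF u x, of "l *\<^sub>R w"]
  have int: "integrable lebesgue (\<lambda>y. W y * d y)"
    unfolding Wd using ints by (intro Bochner_Integration.integrable_diff)
  have "(LINT y|lebesgue. W y * d y) = energy u x' - energy u x - moment u x \<bullet> (l *\<^sub>R w)"
    unfolding Wd energy_def moment_inner(1)[OF u x, of "l *\<^sub>R w", symmetric]
    using ints by (simp only: Bochner_Integration.integral_diff Bochner_Integration.integrable_diff)
  also have "\<dots> \<le> 0" using le zero by simp
  finally have "(LINT y|lebesgue. W y * d y) \<le> 0" .
  moreover have nonneg: "0 \<le> W y * d y" for y
    using W_nonneg[of y] W_supp[of y] ge[of y] by (cases "y \<in> C") auto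
  then have "0 \<le> (LINT y|lebesgue. W y * d y)" by (intro integral_nonneg_AE) auto
  ultimately have "(LINT y|lebesgue. W y * d y) = 0" by simp
  then have "AE y in lebesgue. W y * d y = 0"
    using integral_nonneg_eq_0_iff_AE[OF int] nonneg by auto
  with AE_gt have "AE y in lebesgue. W y = 0"
    by eventually_elim (use W_supp in force)
  then have "(LINT y|lebesgue. W y) = 0" by (rule integral_eq_zero_AE)
  then show False using W_pos by simp
qed

text \<open>Closed graph argument: uniform coercivity puts all minimizers into one compact ball, and
  being a minimizer is an intersection of closed conditions on (q, x). A map into a compact set with
  closed graph is continuous.\<close>

lemma continuous_on_minimizer:
  fixes u :: "'a::euclidean_space \<Rightarrow> real^'n \<Rightarrow> real^'n"
  assumes Q: "compact Q"
    and u: "continuous_on (Q \<times> C) (\<lambda>(q, y). u q y)" "\<And>q y. q \<in> Q \<Longrightarrow> y \<in> C \<Longrightarrow> norm (u q y) < 1"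
    and X: "\<And>q. q \<in> Q \<Longrightarrow> norm (X q) < 1"
    and min: "\<And>q x. q \<in> Q \<Longrightarrow> norm x < 1 \<Longrightarrow> x \<noteq> X q \<Longrightarrow> energy (u q) (X q) < energy (u q) x"
  shows "continuous_on Q X"
proof -
  let ?A = "(\<lambda>(q, y). u q y) ` (Q \<times> C)"
  have A: "compact ?A" "?A \<subseteq> ball 0 1"
    using Q C u by (auto intro!: compact_continuous_image compact_Times)
  obtain r where r: "0 < r" "r < 1"
    "\<And>v x. continuous_on C v \<Longrightarrow> v ` C \<subseteq> ?A \<Longrightarrow> r < norm x \<Longrightarrow> norm x < 1 \<Longrightarrow> energy v 0 < energy v x"
    using energy_coercive[OF A] by metis
  have uq: "continuous_on C (u q)" if "q \<in> Q" for q
  proof -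
    have "continuous_on C (\<lambda>y. (\<lambda>(q, y). u q y) (q, y))"
      by (rule continuous_on_compose2[OF u(1)]) (use that in \<open>auto intro!: continuous_intros\<close>)
    then show ?thesis by simp
  qed
  have Xr: "norm (X q) \<le> r" if "q \<in> Q" for q
  proof (rule ccontr)
    assume *: "\<not> norm (X q) \<le> r"
    then have "energy (u q) 0 < energy (u q) (X q)"
      using that X[OF that] by (intro r(3) uq) auto
    moreover have "energy (u q) (X q) < energy (u q) 0"
      using * r(1) that by (intro min) auto
    ultimately show False by simp
  qed
  note E = continuous_on_energy[OF u]
  let ?R = "Q \<times> cball 0 r"
  have graph: "(\<lambda>q. (q, X q)) ` Q =
      (\<Inter>x'\<in>ball 0 1. {s \<in> ?R. energy (u (fst s)) (snd s) \<le> energy (u (fst s)) x'})" (is "_ = ?G")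
  proof (intro equalityI subsetI)
    fix s assume "s \<in> (\<lambda>q. (q, X q)) ` Q"
    then obtain q where q: "q \<in> Q" "s = (q, X q)" by auto
    have "energy (u q) (X q) \<le> energy (u q) x'" if "norm x' < 1" for x'
      using min[OF q(1) that] by (cases "x' = X q") auto
    then show "s \<in> ?G" using q Xr by auto
  next
    fix s assume s: "s \<in> ?G"
    then have sR: "s \<in> ?R" by (metis (mono_tags, lifting) INT_E centre_in_ball mem_Collect_eq zero_less_one)
    then have "energy (u (fst s)) (snd s) \<le> energy (u (fst s)) (X (fst s))"
      using s X[of "fst s"] by auto
    \<comment> \<open>Strictness of the minimum is what makes the closed set a graph.\<close>
    then have "snd s = X (fst s)"
      using min[of "fst s" "snd s"] sR r by force
    then show "s \<in> (\<lambda>q. (q, X q)) ` Q" using sR by (cases s) auto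
  qed
  have "closed {s \<in> ?R. energy (u (fst s)) (snd s) \<le> energy (u (fst s)) x'}" if x': "x' \<in> ball 0 1" for x'
  proof (rule continuous_on_closed_Collect_le)
    have "continuous_on ?R (\<lambda>s. (\<lambda>(q, x). energy (u q) x) (fst s, snd s))"
      by (rule continuous_on_compose2[OF E]) (use r in \<open>auto intro!: continuous_intros\<close>)
    then show "continuous_on ?R (\<lambda>s. energy (u (fst s)) (snd s))" by (simp add: case_prod_unfold)
    have "continuous_on ?R (\<lambda>s. (\<lambda>(q, x). energy (u q) x) (fst s, x'))"
      by (rule continuous_on_compose2[OF E]) (use x' in \<open>auto intro!: continuous_intros\<close>)
    then show "continuous_on ?R (\<lambda>s. energy (u (fst s)) x')" by simp
    show "closed ?R" by (intro closed_Times compact_imp_closed[OF Q] closed_cball)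
  qed
  then have "closed ((\<lambda>q. (q, X q)) ` Q)"
    unfolding graph by (intro closed_INT ballI)
  then show ?thesis
    by (intro continuous_from_closed_graph[of "cball 0 r"]) (use Xr in auto)
qed

end

text \<open>In dimension one uniqueness is claimed only for strictly increasing \<open>g\<close>.
  There all points are collinear, and if \<open>g\<close> is constant from some radius on, two
  clusters of equal mass lying far apart inside the halfball are balanced by a whole interval of
  points x.\<close>

theorem corollary3:
  fixes g :: "real \<Rightarrow> real" and \<Omega> :: "(real^'n) set" and f :: "real^'n \<Rightarrow> real"
  assumes g_cont: "continuous_on {0..<1} g" and g0: "g 0 = 0"
    and \<Omega>_meas: "\<Omega> \<in> sets lebesgue"
    and \<Omega>_cc: "compactly_contained \<Omega> (ball 0 1)"
    and f_nonneg: "\<And>y. y \<in> \<Omega> \<Longrightarrow> 0 \<le> f y"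
    and f_int: "set_integrable lebesgue \<Omega> (\<lambda>y. f y / (1 - (norm y)\<^sup>2) ^ CARD('n))"
    and f_pos: "0 < (LINT y:\<Omega>|lebesgue. f y / (1 - (norm y)\<^sup>2) ^ CARD('n))"
    and g_div: "filterlim (\<lambda>\<rho>. integral {0..\<rho>} (\<lambda>r. g r / (1 - r\<^sup>2))) at_top (at_left 1)"
  shows "(\<forall>p\<in>sphere 0 1. \<forall>t\<in>{-1<..<1}. \<exists>x\<in>ball 0 1.
            orthogonal_on \<Omega> f (radial_field g \<circ> mobius x \<circ> fold_map p t)) \<and>
         (mono_on {0..<1} g \<and> (\<forall>r\<in>{0<..<1}. 0 < g r) \<and>
            (2 \<le> CARD('n) \<or> strict_mono_on {0..<1} g) \<longrightarrow>
            (\<forall>p\<in>sphere 0 1. \<forall>t\<in>{-1<..<1}. \<exists>!x. x \<in> ball 0 1 \<and>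
               orthogonal_on \<Omega> f (radial_field g \<circ> mobius x \<circ> fold_map p t)) \<and>
            continuous_on (sphere 0 1 \<times> {-1<..<1})
              (\<lambda>(p, t). THE x. x \<in> ball 0 1 \<and>
                 orthogonal_on \<Omega> f (radial_field g \<circ> mobius x \<circ> fold_map p t)))"
proof -
  define C where "C = closure \<Omega>"
  define W where "W = (\<lambda>y. indicator \<Omega> y *\<^sub>R (f y / (1 - (norm y)\<^sup>2) ^ CARD('n)))"
  interpret weighted_energy g W C
  proof
    show "compact C" "C \<subseteq> ball 0 1"
      using \<Omega>_cc by (auto simp: compactly_contained_def C_def)
    then have \<Omega>1: "norm y < 1" if "y \<in> \<Omega>" for y
      using that closure_subset[of \<Omega>] by (auto simp: C_def)
    show "integrable lebesgue W" "0 < (LINT y|lebesgue. W y)"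
      using f_int f_pos by (simp_all add: W_def set_integrable_def set_lebesgue_integral_def)
    show "0 \<le> W y" for y
      using f_nonneg[of y] one_minus_norm_sq_pos[OF \<Omega>1, of y]
      by (cases "y \<in> \<Omega>") (auto simp: W_def)
    show "W y = 0" if "y \<notin> C" for y
      using that closure_subset[of \<Omega>] by (auto simp: W_def C_def indicator_def)
    show "filterlim (potential g) at_top (at_left 1)"
      using g_div by (simp add: potential_def[abs_def])
  qed (use g_cont g0 in auto)
  let ?Q = "sphere 0 1 \<times> {-1<..<1} :: ((real^'n) \<times> real) set"
  define F where "F = (\<lambda>q :: (real^'n) \<times> real. fold_map (fst q) (snd q))"
  have q: "norm (fst q) = 1" "\<bar>snd q\<bar> < 1" if "q \<in> ?Q" for q
    using that by (auto simp: mem_Times_iff)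
  have F1: "norm (F q y) < 1" if "q \<in> ?Q" "y \<in> C" for q y
    using norm_fold_map_lt[OF q[OF that(1)]] that C by (auto simp: F_def)
  have F_cont: "continuous_on (?Q \<times> C) (\<lambda>(q, y). F q y)"
    using continuous_on_subset[OF continuous_on_fold_map, of "?Q \<times> C"] C
    by (simp add: F_def case_prod_unfold Sigma_mono)
  have Fq: "continuous_on C (F q)" "F q ` C \<subseteq> ball 0 1" if "q \<in> ?Q" for q
  proof -
    have "continuous_on C (\<lambda>y. (\<lambda>(q, y). F q y) (q, y))"
      by (rule continuous_on_compose2[OF F_cont]) (use that in \<open>auto intro!: continuous_intros\<close>)
    then show "continuous_on C (F q)" by simp
  qed (use F1 that in auto)
  \<comment> \<open>The integrability clause of \<open>orthogonal_on\<close> holds automatically, so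
    only the vanishing of the moment remains.\<close>
  have orth: "orthogonal_on \<Omega> f (radial_field g \<circ> mobius x \<circ> fold_map (fst q) (snd q)) \<longleftrightarrow> moment (F q) x = 0"
    if "q \<in> ?Q" "norm x < 1" for q x
  proof -
    have "indicator \<Omega> y *\<^sub>R (f y / (1 - (norm y)\<^sup>2) ^ CARD('n)) *\<^sub>R v = W y *\<^sub>R v" for y and v :: "real^'n"
      by (simp add: W_def)
    then show ?thesis
      using integrable_field[OF Fq[OF that(1)] that(2)]
      by (simp only: orthogonal_on_def moment_def F_def set_integrable_def set_lebesgue_integral_def o_def simp_thms)
  qed
  have ex: "\<exists>x. norm x < 1 \<and> moment (F q) x = 0" if "q \<in> ?Q" for q
    using energy_minimizer_ex[OF Fq[OF that]] moment_minimizer[OF Fq[OF that]] by metis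
  have existence: "\<forall>p\<in>sphere 0 1. \<forall>t\<in>{-1<..<1}. \<exists>x\<in>ball 0 1.
      orthogonal_on \<Omega> f (radial_field g \<circ> mobius x \<circ> fold_map p t)"
  proof (intro ballI)
    fix p :: "real^'n" and t :: real assume "p \<in> sphere 0 1" "t \<in> {-1<..<1}"
    then have "(p, t) \<in> ?Q" by simp
    from ex[OF this] orth[OF this] show "\<exists>x\<in>ball 0 1. orthogonal_on \<Omega> f (radial_field g \<circ> mobius x \<circ> fold_map p t)"
      by auto
  qed
  moreover have "(\<forall>p\<in>sphere 0 1. \<forall>t\<in>{-1<..<1}. \<exists>!x. x \<in> ball 0 1 \<and>
               orthogonal_on \<Omega> f (radial_field g \<circ> mobius x \<circ> fold_map p t)) \<and>
            continuous_on ?Q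
              (\<lambda>(p, t). THE x. x \<in> ball 0 1 \<and>
                 orthogonal_on \<Omega> f (radial_field g \<circ> mobius x \<circ> fold_map p t))"
    if mono: "mono_on {0..<1} g" and pos: "\<forall>r\<in>{0<..<1}. 0 < g r"
      and dim: "2 \<le> CARD('n) \<or> strict_mono_on {0..<1} g"
  proof -
    have less: "energy (F q) x < energy (F q) x'"
      if "q \<in> ?Q" "norm x < 1" "moment (F q) x = 0" "norm x' < 1" "x' \<noteq> x" for q x x'
    proof (rule energy_less[OF mono _ Fq[OF that(1)] that(2,4,5,3)])
      have "AE y in lebesgue. y \<in> C \<longrightarrow> \<not> collinear {0, w, mobius x (F q y)}"
        if "2 \<le> CARD('n)" "w \<noteq> 0" for w
      proof -
        have "negligible {y \<in> ball 0 1. collinear {0, w, mobius x (F q y)}}"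
          unfolding F_def using negligible_collinear_mobius_fold_map that q[OF \<open>q \<in> ?Q\<close>] \<open>norm x < 1\<close> by blast
        then have "AE y in lebesgue. y \<notin> {y \<in> ball 0 1. collinear {0, w, mobius x (F q y)}}"
          by (intro AE_not_in) (simp add: negligible_iff_null_sets)
        then show ?thesis by eventually_elim (use C in auto)
      qed
      then show "strict_mono_on {0..<1} g \<or>
          (\<forall>w. w \<noteq> 0 \<longrightarrow> (AE y in lebesgue. y \<in> C \<longrightarrow> \<not> collinear {0, w, mobius x (F q y)}))"
        using dim by blast
    qed (use pos in auto)
    \<comment> \<open>Of two distinct critical points each would have strictly less energy than the
      other.\<close>
    have unique: "\<exists>!x. norm x < 1 \<and> moment (F q) x = 0" if "q \<in> ?Q" for q
      using ex[OF that] less[OF that] by (metis order.asym)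
    define X where "X = (\<lambda>q. THE x. norm x < 1 \<and> moment (F q) x = 0)"
    have X: "norm (X q) < 1" "moment (F q) (X q) = 0" if "q \<in> ?Q" for q
      using theI'[OF unique[OF that]] by (auto simp: X_def)
    have orth_iff: "x \<in> ball 0 1 \<and> orthogonal_on \<Omega> f (radial_field g \<circ> mobius x \<circ> fold_map p t)
        \<longleftrightarrow> norm x < 1 \<and> moment (F (p, t)) x = 0" if "p \<in> sphere 0 1" "t \<in> {-1<..<1}" for p t x
      using orth[of "(p, t)" x] that by auto
    have "continuous (at q within ?Q) X" if qQ: "q \<in> ?Q" for q
    proof -
      \<comment> \<open>The parameter set is not compact, as t ranges over an open interval.
        Continuity is local, so a compact slab whose interior in t contains the given parameter is
        enough.\<close>
      define a where "a = (\<bar>snd q\<bar> + 1) / 2"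
      have a: "\<bar>snd q\<bar> < a" "a < 1" using q[OF qQ] by (auto simp: a_def)
      let ?K = "sphere 0 1 \<times> {-a..a} :: ((real^'n) \<times> real) set"
      have K: "?K \<subseteq> ?Q" using a by auto
      have "continuous_on ?K X"
      proof (rule continuous_on_minimizer[where u = F])
        show "compact ?K" by (intro compact_Times) auto
        show "continuous_on (?K \<times> C) (\<lambda>(q, y). F q y)"
          by (rule continuous_on_subset[OF F_cont]) (use K in blast)
      qed (use K F1 X less in blast)+
      moreover have "q \<in> ?K" using q[OF qQ] a by (auto simp: mem_Times_iff abs_less_iff)
      ultimately have "continuous (at q within ?K) X"
        unfolding continuous_on_eq_continuous_within by blast
      moreover have "at q within ?K = at q within ?Q"
      proof (rule at_within_nhd)
        show "q \<in> UNIV \<times> {-a<..<a}" using a by (auto simp: mem_Times_iff abs_less_iff)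
        show "open (UNIV \<times> {-a<..<a} :: ((real^'n) \<times> real) set)" by (intro open_Times) auto
        show "?K \<inter> UNIV \<times> {-a<..<a} - {q} = ?Q \<inter> UNIV \<times> {-a<..<a} - {q}" using a by auto
      qed
      ultimately show ?thesis by simp
    qed
    then have "continuous_on ?Q X" by (simp add: continuous_on_eq_continuous_within)
    then have "continuous_on ?Q (\<lambda>(p, t). THE x. x \<in> ball 0 1 \<and>
        orthogonal_on \<Omega> f (radial_field g \<circ> mobius x \<circ> fold_map p t))"
      by (rule continuous_on_cong[THEN iffD1, rotated -1]) (auto simp: X_def orth_iff simp del: mem_ball mem_ball_0)
    moreover have "\<forall>p\<in>sphere 0 1. \<forall>t\<in>{-1<..<1}. \<exists>!x. x \<in> ball 0 1 \<and>
               orthogonal_on \<Omega> f (radial_field g \<circ> mobius x \<circ> fold_map p t)"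
      using unique by (simp add: orth_iff del: mem_ball mem_ball_0)
    ultimately show ?thesis by blast
  qed
  ultimately show ?thesis by blast
qed

end
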